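(* Let $F$ be a field and $A\in M_q(F)$, and suppose that the minimal polynomial of $A$ is of the form $m_A=X^{t_0}\prod_{j=1}^{p}(X-\lambda_j)^{t_j}$ with $\lambda_1,\dots,\lambda_p$ distinct nonzero elements of $F$ (possibly $t_0=0$). Let $m=\max\{t_1-1,\ldots,t_p-1\}$ (with $m=-1$ if $p=0$), and let $\pi_0,\pi_1,\ldots,\pi_p$ be the spectral projections of $A$ at $0,\lambda_1,\ldots,\lambda_p$ respectively. Let $\pmb{A}=(A^k)_{k\ge0}$, let $\pmb{N}(A)$ be its non-geometric part and let $\pmb{\mathcal{A}}_i$ ($i\ge0$) be the $i$th coordinate of $A$ with respect to $(\mathcal{S}^{\ast},\mathcal{T})$. Then: 1. $\pmb{\mathcal{A}}_i=\sum_{j=1}^{p}\pmb{\lambda}_j\lambda_j^{-i}(A-\lambda_jI_q)^i\pi_j$ for $i\ge1$, and $\pmb{\mathcal{A}}_0=\pmb{\lambda}_1\pi_1+\cdots+\pmb{\lambda}_p\pi_p$. 2. $\pmb{N}(A)=\sum_{i=0}^{t_0-1}\pmb{0}_iA^i\pi_0$ (and $\pmb{N}(A)=0$ if and only if $t_0=0$). 3. $A$ is nilpotent if and only if every $\pmb{\mathcal{A}}_i$ is zero, i.e. $\pmb{A}=\pmb{N}(A)$. 4. $\pmb{\mathcal{A}}_i=0$ if and only if $i>m$. 5. If $A$ is not nilpotent, then no coordinate $\pmb{\mathcal{A}}_i$, $1\le i\le m$, is identically zero. 6. For every $i\ge1$, $\pmb{\mathcal{A}}_i=\sum_{j=1}^{p}\pmb{\lambda}_j\lambda_j^{-i}(A-\lambda_jI_q)^i\pi_j$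 is a nilpotent matrix. 7. $\pmb{N}(A)=\pmb{0}_0\pi_0+\pmb{N}$, where $\pmb{N}=\sum_{i=1}^{t_0-1}\pmb{0}_iA^i\pi_0$ is a nilpotent matrix. 8. $\pmb{A}=(\pmb{N}+\pmb{\mathcal{A}}_1\pmb{\Lambda}_1+\cdots+\pmb{\mathcal{A}}_m\pmb{\Lambda}_m)+(\pmb{0}_0\pi_0+\pmb{\mathcal{A}}_0\pmb{\Lambda}_0)$ is the unique decomposition of $\pmb{A}$ as a sum of commuting nilpotent and diagonalizable matrices (the first bracket being the nilpotent one, the second the diagonalizable one).
   Context: $\mathcal{C}_F$ is the $F$-algebra of all sequences $(s_k)_{k\ge 0}$ over $F$ with componentwise operations. Sequences of $q\times q$ matrices over $F$ are identified with elements of the ring $M_q(\mathcal{C}_F)$; nilpotent, commuting and diagonalizable are understood in $M_q(\mathcal{C}_F)$. Zeroth powers of matrices are $I_q$. For $\lambda\in F\setminus\{0\}$, $\pmb{\lambda}=(\lambda^k)_{k\ge0}$; $\mathcal{S}^{\ast}=\{\pmb{\lambda}:\lambda\in F,\lambda\ne0\}$; for $i\in\mathbb{N}$, $\pmb{0}_i$ is the sequence with $\pmb{0}_i(k)=\delta_{ik}$; $\mathcal{S}^{\circ}=\{\pmb{0}_i:i\ge0\}$. $F_{\mathcal{S}^{\ast}}$ and $F_{\mathcal{S}^{\circ}}$ are the $F$-spans of $\mathcal{S}^{\ast}$ and $\mathcal{S}^{\circ}$. For $i\ge0$, $\pmb{\Lambda}_i=(\binom{k}{i})_{k\ge0}$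 (integers viewed in $F$), and $\mathcal{T}=\{\pmb{\Lambda}_i:i\ge0\}$. If the characteristic polynomial of $A$ splits over $F$, then $\pmb{A}=(A^k)_{k\ge0}$ can be written in exactly one way (up to zero terms) as $$\pmb{A}=\pmb{N}(A)+\pmb{\mathcal{A}}_0\pmb{\Lambda}_0+\cdots+\pmb{\mathcal{A}}_l\pmb{\Lambda}_l,\qquad \pmb{N}(A)\in M_q(F_{\mathcal{S}^{\circ}}),\ \pmb{\mathcal{A}}_i\in M_q(F_{\mathcal{S}^{\ast}}).$$ This is the $\mathcal{P}$-canonical form of $A$ relative to $(\mathcal{S}^{\ast},\mathcal{T})$; $\pmb{N}(A)$ is the non-geometric part, $\pmb{\mathcal{A}}_0\pmb{\Lambda}_0+\cdots+\pmb{\mathcal{A}}_l\pmb{\Lambda}_l$ is the geometric part, and $\pmb{\mathcal{A}}_i$ is the $i$th coordinate of $A$ with respect to $(\mathcal{S}^{\ast},\mathcal{T})$ (with $\pmb{\mathcal{A}}_i=0$ for $i>l$). The spectral projection $\pi_j$ (resp. $\pi_0$) is the projection onto $\ker(A-\lambda_jI_q)^{t_j}$ (resp. $\ker A^{t_0}$) along the sum of the other generalized eigenspaces; $\pi_0=0$ if $t_0=0$. Empty sums are $0$. *)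

theory Defs
  imports
    "HOL-Library.Function_Algebras"
    "Jordan_Normal_Form.Matrix_Kernel"
begin

text \<open>
  Square matrices are those of \<open>Jordan_Normal_Form\<close>: \<open>M\<^sub>q(R)\<close> is \<open>carrier_mat q q\<close>.
  The algebra of sequences over a field \<open>'a\<close> is the function type \<open>nat \<Rightarrow> 'a\<close> with the
  componentwise ring structure of \<open>Function_Algebras\<close>, so that matrices over it have type
  \<open>(nat \<Rightarrow> 'a) mat\<close>.
\<close>

subsection \<open>Matrices over a ring\<close>

text \<open>The library has no sum over a set for the type \<open>mat\<close>, whose zero depends on the dimension.\<close>

definition mat_sum :: "nat \<Rightarrow> ('i \<Rightarrow> 'r::comm_monoid_add mat) \<Rightarrow> 'i set \<Rightarrow> 'r mat" where
  "mat_sum q f I = mat q q (\<lambda>(r, s). \<Sum>i\<in>I. f i $$ (r, s))"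

definition nilpotent_mat :: "'r::semiring_1 mat \<Rightarrow> bool" where
  "nilpotent_mat M \<longleftrightarrow> (\<exists>n. M ^\<^sub>m n = 0\<^sub>m (dim_row M) (dim_row M))"

definition diagonalizable_mat :: "'r::semiring_1 mat \<Rightarrow> bool" where
  "diagonalizable_mat M \<longleftrightarrow> (\<exists>D. similar_mat M D \<and> diagonal_mat D)"

definition is_nilpotent_diagonalizable_sum ::
  "nat \<Rightarrow> 'r::semiring_1 mat \<Rightarrow> 'r mat \<Rightarrow> 'r mat \<Rightarrow> bool" where
  "is_nilpotent_diagonalizable_sum q M X Y \<longleftrightarrow>
     X \<in> carrier_mat q q \<and> Y \<in> carrier_mat q q \<and> M = X + Y \<and> X * Y = Y * X \<and>
     nilpotent_mat X \<and> diagonalizable_mat Y"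

definition poly_mat :: "'a::field poly \<Rightarrow> 'a mat \<Rightarrow> 'a mat" where
  "poly_mat f A = mat_sum (dim_row A) (\<lambda>i. coeff f i \<cdot>\<^sub>m (A ^\<^sub>m i)) {..degree f}"

definition is_minimal_poly :: "'a::field mat \<Rightarrow> 'a poly \<Rightarrow> bool" where
  "is_minimal_poly A f \<longleftrightarrow>
     lead_coeff f = 1 \<and> poly_mat f A = 0\<^sub>m (dim_row A) (dim_row A) \<and>
     (\<forall>g. poly_mat g A = 0\<^sub>m (dim_row A) (dim_row A) \<longrightarrow> f dvd g)"

subsection \<open>Spectral projections\<close>

definition is_projection_along ::
  "nat \<Rightarrow> 'a::field vec set \<Rightarrow> 'a vec set \<Rightarrow> 'a mat \<Rightarrow> bool" where
  "is_projection_along q U W P \<longleftrightarrow>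
     P \<in> carrier_mat q q \<and> P * P = P \<and>
     (\<lambda>v. P *\<^sub>v v) ` carrier_vec q = U \<and> mat_kernel P = W"

definition projection_along :: "nat \<Rightarrow> 'a::field vec set \<Rightarrow> 'a vec set \<Rightarrow> 'a mat" where
  "projection_along q U W = (THE P. is_projection_along q U W P)"

definition sum_of_subspaces ::
  "nat \<Rightarrow> ('i \<Rightarrow> 'a::field vec set) \<Rightarrow> 'i set \<Rightarrow> 'a vec set" where
  "sum_of_subspaces q W I = {finsum_vec TYPE('a) q w I | w. \<forall>i\<in>I. w i \<in> W i}"

definition gen_eigenspace :: "'a::field mat \<Rightarrow> 'a \<Rightarrow> nat \<Rightarrow> 'a vec set" where
  "gen_eigenspace A c e = mat_kernel ((A - c \<cdot>\<^sub>m 1\<^sub>m (dim_row A)) ^\<^sub>m e)"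

text \<open>
  The eigenvalues are \<open>ev i\<close> with exponents \<open>t i\<close>, for \<open>i \<in> I\<close>. An index with \<open>t j = 0\<close> has
  generalized eigenspace \<open>{0}\<close>, so its projection is \<open>0\<close>.
\<close>

definition spectral_projection ::
  "'a::field mat \<Rightarrow> 'i set \<Rightarrow> ('i \<Rightarrow> 'a) \<Rightarrow> ('i \<Rightarrow> nat) \<Rightarrow> 'i \<Rightarrow> 'a mat" where
  "spectral_projection A I ev t j =
     projection_along (dim_row A) (gen_eigenspace A (ev j) (t j))
       (sum_of_subspaces (dim_row A) (\<lambda>i. gen_eigenspace A (ev i) (t i)) (I - {j}))"

subsection \<open>Sequences and matrices of sequences\<close>

definition seq_scale :: "'a::field \<Rightarrow> (nat \<Rightarrow> 'a) \<Rightarrow> (nat \<Rightarrow> 'a)" where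
  "seq_scale c s = (\<lambda>k. c * s k)"

interpretation seq: vector_space seq_scale
  by unfold_locales (auto simp: seq_scale_def fun_eq_iff algebra_simps)

definition geo_seq :: "'a::field \<Rightarrow> (nat \<Rightarrow> 'a)" where
  "geo_seq c = (\<lambda>k. c ^ k)"

definition delta_seq :: "nat \<Rightarrow> (nat \<Rightarrow> 'a::field)" where
  "delta_seq i = (\<lambda>k. if k = i then 1 else 0)"

definition binom_seq :: "nat \<Rightarrow> (nat \<Rightarrow> 'a::field)" where
  "binom_seq i = (\<lambda>k. of_nat (k choose i))"

definition span_geo :: "(nat \<Rightarrow> 'a::field) set" where
  "span_geo = seq.span {geo_seq c | c. c \<noteq> 0}"

definition span_delta :: "(nat \<Rightarrow> 'a::field) set" where
  "span_delta = seq.span (range delta_seq)"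

text \<open>The identification of a sequence of matrices with a matrix of sequences.\<close>

definition mat_of_seq :: "nat \<Rightarrow> (nat \<Rightarrow> 'a mat) \<Rightarrow> (nat \<Rightarrow> 'a) mat" where
  "mat_of_seq q S = mat q q (\<lambda>(r, s). \<lambda>k. S k $$ (r, s))"

definition power_seq :: "'a::field mat \<Rightarrow> (nat \<Rightarrow> 'a) mat" where
  "power_seq A = mat_of_seq (dim_row A) (\<lambda>k. A ^\<^sub>m k)"

text \<open>
  The product of a sequence \<open>s\<close> and a matrix \<open>B\<close> over the field, i.e. the sequence of matrices
  \<open>k \<mapsto> s(k) B\<close>.
\<close>

definition seq_times_mat :: "(nat \<Rightarrow> 'a::field) \<Rightarrow> 'a mat \<Rightarrow> (nat \<Rightarrow> 'a) mat" where
  "seq_times_mat s B = s \<cdot>\<^sub>m map_mat (\<lambda>c k. c) B"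

subsection \<open>The canonical form\<close>

text \<open>
  The coordinates are given as an infinite family that vanishes from some index on; this makes
  the form unique and not only unique up to zero terms.
\<close>

definition is_canonical_form ::
  "'a::field mat \<Rightarrow> (nat \<Rightarrow> 'a) mat \<times> (nat \<Rightarrow> (nat \<Rightarrow> 'a) mat) \<Rightarrow> bool" where
  "is_canonical_form A = (\<lambda>(N, C).
     let q = dim_row A in
       N \<in> carrier_mat q q \<and> elements_mat N \<subseteq> span_delta \<and>
       (\<forall>i. C i \<in> carrier_mat q q \<and> elements_mat (C i) \<subseteq> span_geo) \<and>
       (\<exists>l. (\<forall>i>l. C i = 0\<^sub>m q q) \<and>
            power_seq A = N + mat_sum q (\<lambda>i. binom_seq i \<cdot>\<^sub>m C i) {..l}))"

definition canonical_form ::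
  "'a::field mat \<Rightarrow> (nat \<Rightarrow> 'a) mat \<times> (nat \<Rightarrow> (nat \<Rightarrow> 'a) mat)" where
  "canonical_form A = (THE NC. is_canonical_form A NC)"

definition nongeometric_part :: "'a::field mat \<Rightarrow> (nat \<Rightarrow> 'a) mat" where
  "nongeometric_part A = fst (canonical_form A)"

definition coordinate :: "'a::field mat \<Rightarrow> nat \<Rightarrow> (nat \<Rightarrow> 'a) mat" where
  "coordinate A i = snd (canonical_form A) i"

end

theory Submission
  imports Defs "Jordan_Normal_Form.DL_Rank"
begin

text \<open>
  Everything is computed in \<open>F[X]/(m\<^sub>A)\<close>. A matrix \<open>f(A)\<close> vanishes iff each prime power
  \<open>(X - \<lambda>\<^sub>j) ^ t\<^sub>j\<close> divides \<open>f\<close>, and \<open>f(A)\<close> is nilpotent as soon as \<open>f\<close> vanishes at all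
  eigenvalues. With the idempotents \<open>e\<^sub>j\<close> of the Chinese remainder theorem, \<open>\<pi>\<^sub>j = e\<^sub>j(A)\<close>
  (\<open>spectral_projection_eq\<close>). Since \<open>1 = \<Sum> e\<^sub>j\<close> modulo \<open>m\<^sub>A\<close>, expanding
  \<open>X ^ k = ((X - \<lambda>\<^sub>j) + \<lambda>\<^sub>j) ^ k\<close> on the \<open>j\<close>th component gives an expression for \<open>A ^ k\<close> of the
  required shape (\<open>power_seq_eq\<close>).

  This expression is the canonical form because the canonical form is unique
  (\<open>is_canonical_form_unique\<close>). Entrywise, uniqueness says that the sequences \<open>(k choose i) \<lambda> ^ k\<close>
  with \<open>\<lambda> \<noteq> 0\<close> are linearly independent modulo finitely supported sequences, in any characteristic
  (\<open>binom_geo_independent\<close>): pairing such a sequence with the coefficients of a polynomial \<open>f\<close> yields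
  \<open>\<lambda> ^ i\<close> times the \<open>i\<close>th Taylor coefficient of \<open>f\<close> at \<open>\<lambda>\<close>, and \<open>f\<close> can be chosen such that a
  single one of the relevant Taylor coefficients survives.

  The vanishing and nilpotency statements are then divisibility statements about explicit
  polynomials, checked term by term in \<open>k\<close>. For the decomposition into a nilpotent and a
  diagonalizable part, the \<open>k\<close>th term of the diagonalizable part is the semisimple part
  \<open>\<Sum> \<lambda>\<^sub>j ^ k \<pi>\<^sub>j\<close> of \<open>A ^ k\<close>, where the sum includes the eigenvalue \<open>0\<close> and \<open>0 ^ 0 = 1\<close>. One basis of
  vectors from the images of the \<open>\<pi>\<^sub>j\<close> diagonalizes all terms, hence the sequence
  (\<open>semisimple_diagonalization\<close>). Conversely, in any such decomposition the terms decompose \<open>A ^ k\<close>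
  over \<open>F\<close>, and there the diagonalizable summand is forced to be the semisimple part
  (\<open>semisimple_unique\<close>).
\<close>

section \<open>Sums and columns of matrices\<close>

lemma mat_sum_carrier [simp]: "mat_sum q f I \<in> carrier_mat q q"
  by (simp add: mat_sum_def)

lemma dim_mat_sum [simp]: "dim_row (mat_sum q f I) = q" "dim_col (mat_sum q f I) = q"
  by (simp_all add: mat_sum_def)

lemma index_mat_sum [simp]:
  "r < q \<Longrightarrow> s < q \<Longrightarrow> mat_sum q f I $$ (r, s) = (\<Sum>i\<in>I. f i $$ (r, s))"
  by (simp add: mat_sum_def)

lemma mat_sum_cong: "(\<And>i. i \<in> I \<Longrightarrow> f i = g i) \<Longrightarrow> mat_sum q f I = mat_sum q g I"
  by (simp add: mat_sum_def cong: sum.cong)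

lemma mat_sum_insert:
  assumes "finite K" "j \<notin> K" "E j \<in> carrier_mat q q"
  shows "mat_sum q E (insert j K) = E j + mat_sum q E K"
  using assms by (intro eq_matI) auto

lemma mat_sum_empty: "mat_sum q E {} = 0\<^sub>m q q"
  by (rule eq_matI) auto

lemma index_mult_mat_vec_mat_sum:
  fixes E :: "'i \<Rightarrow> 'a::comm_semiring_0 mat"
  assumes E: "\<And>j. j \<in> J \<Longrightarrow> E j \<in> carrier_mat q q" and v: "v \<in> carrier_vec q" and r: "r < q"
  shows "(mat_sum q E J *\<^sub>v v) $ r = (\<Sum>j\<in>J. (E j *\<^sub>v v) $ r)"
proof -
  have "(mat_sum q E J *\<^sub>v v) $ r = (\<Sum>k = 0..<q. (\<Sum>j\<in>J. E j $$ (r, k)) * v $ k)"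
    using v r by (simp add: scalar_prod_def)
  also have "\<dots> = (\<Sum>j\<in>J. \<Sum>k = 0..<q. E j $$ (r, k) * v $ k)"
    by (simp add: sum_distrib_right) (rule sum.swap)
  also have "\<dots> = (\<Sum>j\<in>J. (E j *\<^sub>v v) $ r)"
  proof (rule sum.cong[OF refl])
    fix j assume "j \<in> J"
    from E[OF this] show "(\<Sum>k = 0..<q. E j $$ (r, k) * v $ k) = (E j *\<^sub>v v) $ r"
      using v r by (simp add: scalar_prod_def)
  qed
  finally show ?thesis .
qed

lemma mult_mat_sum:
  fixes B :: "'a::comm_semiring_0 mat"
  assumes B: "B \<in> carrier_mat q q" and f: "\<And>i. i \<in> I \<Longrightarrow> f i \<in> carrier_mat q q"
  shows "B * mat_sum q f I = mat_sum q (\<lambda>i. B * f i) I"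
proof (rule eq_matI)
  fix r s assume "r < dim_row (mat_sum q (\<lambda>i. B * f i) I)" "s < dim_col (mat_sum q (\<lambda>i. B * f i) I)"
  then have rs: "r < q" "s < q" by simp_all
  have "(B * mat_sum q f I) $$ (r, s) = (\<Sum>k = 0..<q. B $$ (r, k) * (\<Sum>i\<in>I. f i $$ (k, s)))"
    using B rs by (simp add: scalar_prod_def)
  also have "\<dots> = (\<Sum>i\<in>I. \<Sum>k = 0..<q. B $$ (r, k) * f i $$ (k, s))"
    by (simp add: sum_distrib_left) (rule sum.swap)
  also have "\<dots> = (\<Sum>i\<in>I. (B * f i) $$ (r, s))"
  proof (rule sum.cong[OF refl])
    fix i assume "i \<in> I"
    from f[OF this] show "(\<Sum>k = 0..<q. B $$ (r, k) * f i $$ (k, s)) = (B * f i) $$ (r, s)"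
      using B rs by (simp add: scalar_prod_def)
  qed
  finally show "(B * mat_sum q f I) $$ (r, s) = mat_sum q (\<lambda>i. B * f i) I $$ (r, s)"
    using rs by simp
qed (use B in auto)

lemma pow_mat_Suc_left:
  fixes A :: "'a::semiring_1 mat"
  assumes "A \<in> carrier_mat q q"
  shows "A ^\<^sub>m Suc n = A * A ^\<^sub>m n"
proof (induction n)
  case 0
  then show ?case using assms by simp
next
  case (Suc n)
  have "A ^\<^sub>m Suc (Suc n) = (A * A ^\<^sub>m n) * A" using Suc by simp
  also have "\<dots> = A * (A ^\<^sub>m n * A)"
    using assms by (intro assoc_mult_mat) (auto intro: pow_carrier_mat)
  finally show ?case by simp
qed

lemma smult_smult_mat: "a \<cdot>\<^sub>m (b \<cdot>\<^sub>m B) = (a * b :: 'a::semigroup_mult) \<cdot>\<^sub>m B"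
  by (rule eq_matI) (simp_all add: mult.assoc)

lemma one_smult_mat: "(1 :: 'a::monoid_mult) \<cdot>\<^sub>m B = B"
  by (rule eq_matI) simp_all

lemma eq_mat_by_columns:
  assumes "B \<in> carrier_mat q q" "C \<in> carrier_mat q q" "\<And>c. c < q \<Longrightarrow> col B c = col C c"
  shows "B = C"
proof (rule eq_matI)
  fix r s assume "r < dim_row C" "s < dim_col C"
  then have rs: "r < q" "s < q" using assms(2) by simp_all
  have "col B s $ r = col C s $ r" using assms(3)[OF rs(2)] by simp
  then show "B $$ (r, s) = C $$ (r, s)" using assms(1,2) rs by simp
qed (use assms in auto)

lemma col_mult_diagonal_mat:
  fixes P D :: "'a::comm_semiring_1 mat"
  assumes P: "P \<in> carrier_mat q q" and D: "D \<in> carrier_mat q q" "diagonal_mat D" and c: "c < q"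
  shows "col (P * D) c = D $$ (c, c) \<cdot>\<^sub>v col P c"
proof (rule eq_vecI)
  fix r assume "r < dim_vec (D $$ (c, c) \<cdot>\<^sub>v col P c)"
  then have r: "r < q" using P by simp
  have "(P * D) $$ (r, c) = (\<Sum>k = 0..<q. P $$ (r, k) * D $$ (k, c))"
    using P D(1) r c by (simp add: scalar_prod_def)
  also have "\<dots> = (\<Sum>k = 0..<q. if k = c then P $$ (r, c) * D $$ (c, c) else 0)"
    using D c unfolding diagonal_mat_def by (intro sum.cong refl) auto
  also have "\<dots> = P $$ (r, c) * D $$ (c, c)" using c by simp
  finally show "col (P * D) c $ r = (D $$ (c, c) \<cdot>\<^sub>v col P c) $ r"
    using P D(1) r c by (simp add: mult.commute)
qed (use P in simp)

lemma diagonalization_by_columns: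
  fixes B P Q D :: "'a::comm_ring_1 mat"
  assumes B: "B \<in> carrier_mat q q" and P: "P \<in> carrier_mat q q" and Q: "Q \<in> carrier_mat q q" "P * Q = 1\<^sub>m q"
    and D: "D \<in> carrier_mat q q" "diagonal_mat D"
    and eig: "\<And>c. c < q \<Longrightarrow> B *\<^sub>v col P c = D $$ (c, c) \<cdot>\<^sub>v col P c"
  shows "B = P * D * Q"
proof -
  have "B * P = P * D"
  proof (rule eq_mat_by_columns[OF mult_carrier_mat[OF B P] mult_carrier_mat[OF P D(1)]])
    fix c assume c: "c < q"
    show "col (B * P) c = col (P * D) c"
      unfolding col_mult2[OF B P c] col_mult_diagonal_mat[OF P D c] by (rule eig[OF c])
  qed
  then have "P * D * Q = B * (P * Q)" using assoc_mult_mat[OF B P Q(1)] by simp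
  then show ?thesis using B Q by simp
qed

section \<open>Polynomials in a matrix\<close>

lemma dim_poly_mat [simp]: "dim_row (poly_mat f A) = dim_row A" "dim_col (poly_mat f A) = dim_row A"
  by (simp_all add: poly_mat_def)

lemma poly_mat_carrier: "A \<in> carrier_mat q q \<Longrightarrow> poly_mat f A \<in> carrier_mat q q"
  by (simp add: poly_mat_def)

lemma poly_mat_eq_mat_sum:
  assumes "A \<in> carrier_mat q q" "degree f \<le> n"
  shows "poly_mat f A = mat_sum q (\<lambda>i. coeff f i \<cdot>\<^sub>m (A ^\<^sub>m i)) {..n}"
proof (rule eq_matI)
  fix r s assume "r < dim_row (mat_sum q (\<lambda>i. coeff f i \<cdot>\<^sub>m (A ^\<^sub>m i)) {..n})"
    "s < dim_col (mat_sum q (\<lambda>i. coeff f i \<cdot>\<^sub>m (A ^\<^sub>m i)) {..n})"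
  then have "r < q" "s < q" by simp_all
  moreover have "(\<Sum>i\<le>degree f. coeff f i * (A ^\<^sub>m i) $$ (r, s))
      = (\<Sum>i\<le>n. coeff f i * (A ^\<^sub>m i) $$ (r, s))"
    using assms(2) by (intro sum.mono_neutral_left) (auto simp: coeff_eq_0)
  ultimately show "poly_mat f A $$ (r, s) = mat_sum q (\<lambda>i. coeff f i \<cdot>\<^sub>m (A ^\<^sub>m i)) {..n} $$ (r, s)"
    using assms(1) by (simp add: poly_mat_def)
qed (use assms in \<open>simp_all add: poly_mat_def\<close>)

lemma index_poly_mat:
  assumes "A \<in> carrier_mat q q" "degree f \<le> n" "r < q" "s < q"
  shows "poly_mat f A $$ (r, s) = (\<Sum>i\<le>n. coeff f i * (A ^\<^sub>m i) $$ (r, s))"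
  using assms by (simp add: poly_mat_eq_mat_sum)

lemma poly_mat_add:
  assumes A: "A \<in> carrier_mat q q"
  shows "poly_mat (f + g) A = poly_mat f A + poly_mat g A"
proof (rule eq_matI)
  fix r s assume "r < dim_row (poly_mat f A + poly_mat g A)" "s < dim_col (poly_mat f A + poly_mat g A)"
  then have rs: "r < q" "s < q" using A by simp_all
  let ?n = "max (degree f) (degree g)"
  have "degree (f + g) \<le> ?n" by (simp add: degree_add_le_max)
  then show "poly_mat (f + g) A $$ (r, s) = (poly_mat f A + poly_mat g A) $$ (r, s)"
    using rs A by (simp add: index_poly_mat[OF A, of _ ?n] algebra_simps sum.distrib)
qed (use A in simp_all)

lemma poly_mat_smult:
  assumes A: "A \<in> carrier_mat q q"
  shows "poly_mat (Polynomial.smult c f) A = c \<cdot>\<^sub>m poly_mat f A"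
proof (rule eq_matI)
  fix r s assume "r < dim_row (c \<cdot>\<^sub>m poly_mat f A)" "s < dim_col (c \<cdot>\<^sub>m poly_mat f A)"
  then have rs: "r < q" "s < q" using A by simp_all
  then show "poly_mat (Polynomial.smult c f) A $$ (r, s) = (c \<cdot>\<^sub>m poly_mat f A) $$ (r, s)"
    using A by (simp add: index_poly_mat[OF A, of _ "degree f"] algebra_simps sum_distrib_left
        degree_smult_le)
qed (use A in simp_all)

lemma poly_mat_0: "A \<in> carrier_mat q q \<Longrightarrow> poly_mat 0 A = 0\<^sub>m q q"
  by (rule eq_matI) (auto simp: poly_mat_def)

lemma poly_mat_1: "A \<in> carrier_mat q q \<Longrightarrow> poly_mat 1 A = 1\<^sub>m q"
  by (rule eq_matI) (auto simp: poly_mat_def)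

lemma poly_mat_shift:
  assumes A: "A \<in> carrier_mat q q"
  shows "poly_mat (pCons 0 f) A = A * poly_mat f A"
proof -
  have "poly_mat (pCons 0 f) A
      = mat_sum q (\<lambda>i. coeff (pCons 0 f) i \<cdot>\<^sub>m (A ^\<^sub>m i)) {..Suc (degree f)}"
    using A by (intro poly_mat_eq_mat_sum) (simp_all add: degree_pCons_le)
  also have "\<dots> = mat_sum q (\<lambda>i. coeff f i \<cdot>\<^sub>m (A ^\<^sub>m Suc i)) {..degree f}"
  proof (rule eq_matI, goal_cases)
    case (1 r s)
    then show ?case using A
      by (simp add: sum.atMost_Suc_shift del: sum.atMost_Suc pow_mat.simps(2))
  qed simp_all
  also have "\<dots> = mat_sum q (\<lambda>i. A * (coeff f i \<cdot>\<^sub>m (A ^\<^sub>m i))) {..degree f}"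
    using A by (intro mat_sum_cong)
      (simp add: pow_mat_Suc_left mult_smult_distrib[OF A pow_carrier_mat[OF A]] del: pow_mat.simps(2))
  also have "\<dots> = A * poly_mat f A"
    using A by (simp add: mult_mat_sum poly_mat_def pow_carrier_mat)
  finally show ?thesis .
qed

lemma poly_mat_mult:
  assumes A: "A \<in> carrier_mat q q"
  shows "poly_mat (f * g) A = poly_mat f A * poly_mat g A"
proof (induction f)
  case 0
  then show ?case using left_mult_zero_mat[OF poly_mat_carrier[OF A, of g], of q]
    by (simp add: poly_mat_0[OF A])
next
  case (pCons a f)
  note c = poly_mat_carrier[OF A]
  have "poly_mat (pCons a f * g) A = a \<cdot>\<^sub>m poly_mat g A + A * (poly_mat f A * poly_mat g A)"
    using pCons by (simp add: poly_mat_add[OF A] poly_mat_smult[OF A] poly_mat_shift[OF A])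
  also have "\<dots> = (a \<cdot>\<^sub>m 1\<^sub>m q + A * poly_mat f A) * poly_mat g A"
    using A c[of f] c[of g]
    by (simp add: add_mult_distrib_mat[of _ q q _ _ q] assoc_mult_mat[OF A c c]
        mult_smult_assoc_mat[of _ q q _ q])
  also have "a \<cdot>\<^sub>m 1\<^sub>m q + A * poly_mat f A = poly_mat (pCons a f) A"
    using poly_mat_add[OF A, of "Polynomial.smult a 1" "pCons 0 f"]
    by (simp only: poly_mat_smult[OF A] poly_mat_1[OF A] poly_mat_shift[OF A]) (simp add: one_pCons)
  finally show ?case .
qed

lemma poly_mat_X: "A \<in> carrier_mat q q \<Longrightarrow> poly_mat [:0, 1:] A = A"
  by (simp add: poly_mat_shift poly_mat_1 flip: one_pCons)

lemma poly_mat_uminus: 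
  assumes A: "A \<in> carrier_mat q q"
  shows "poly_mat (- f) A = - poly_mat f A"
  using poly_mat_smult[OF A, of "-1" f] poly_mat_carrier[OF A, of f] by auto

lemma poly_mat_diff:
  assumes A: "A \<in> carrier_mat q q"
  shows "poly_mat (f - g) A = poly_mat f A - poly_mat g A"
  using poly_mat_add[OF A, of f "- g"] poly_mat_uminus[OF A, of g]
    poly_mat_carrier[OF A, of f] poly_mat_carrier[OF A, of g]
  by (simp add: add_uminus_minus_mat)

lemma poly_mat_linear:
  assumes A: "A \<in> carrier_mat q q"
  shows "poly_mat [:- c, 1:] A = A - c \<cdot>\<^sub>m 1\<^sub>m q"
proof -
  have "[:- c, 1:] = [:0, 1:] - Polynomial.smult c 1" by (simp add: one_pCons)
  then show ?thesis
    by (simp only: poly_mat_diff[OF A] poly_mat_X[OF A] poly_mat_smult[OF A] poly_mat_1[OF A])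
qed

lemma poly_mat_power:
  assumes A: "A \<in> carrier_mat q q"
  shows "poly_mat (f ^ n) A = poly_mat f A ^\<^sub>m n"
proof (induction n)
  case 0
  show ?case using A by (simp add: poly_mat_1[OF A])
next
  case (Suc n)
  then show ?case by (simp add: poly_mat_mult[OF A] power_Suc2 del: power_Suc)
qed

lemma poly_mat_sum:
  assumes A: "A \<in> carrier_mat q q"
  shows "poly_mat (\<Sum>i\<in>I. f i) A = mat_sum q (\<lambda>i. poly_mat (f i) A) I"
proof (induction I rule: infinite_finite_induct)
  case (infinite I)
  then show ?case by (simp add: poly_mat_0[OF A]) (auto intro: eq_matI)
next
  case empty
  then show ?case by (simp add: poly_mat_0[OF A]) (auto intro: eq_matI)
next
  case (insert i I)
  then show ?case using poly_mat_carrier[OF A]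
    by (simp add: poly_mat_add[OF A]) (auto intro!: eq_matI)
qed

section \<open>Congruences modulo powers of distinct linear factors\<close>

lemma linear_power_dvd_one_minus_power:
  fixes h :: "'a::field poly"
  assumes "poly h c \<noteq> 0"
  shows "[:- c, 1:] ^ n dvd (1 - Polynomial.smult (1 / poly h c) h) ^ n"
  using assms by (intro dvd_power_same) (simp add: dvd_iff_poly_eq_0)

lemma inverse_mod_linear_power:
  fixes h :: "'a::field poly"
  assumes "poly h c \<noteq> 0"
  obtains b where "[:- c, 1:] ^ n dvd 1 - b * h" 
proof -
  define u where "u = 1 - Polynomial.smult (1 / poly h c) h"
  have "1 - u dvd 1 - u ^ n"
    using power_diff_sumr2[of 1 n u] by simp
  then obtain k where "1 - u ^ n = (1 - u) * k" by blast
  then have "u ^ n = 1 - (Polynomial.smult (1 / poly h c) k) * h"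
    by (simp add: u_def algebra_simps)
  with linear_power_dvd_one_minus_power[OF assms, of n] show ?thesis
    using that unfolding u_def by metis
qed

lemma linear_power_dvd_mult_cancel:
  fixes h :: "'a::field poly"
  assumes "poly h c \<noteq> 0" "[:- c, 1:] ^ n dvd h * g"
  shows "[:- c, 1:] ^ n dvd g"
proof -
  obtain b where b: "[:- c, 1:] ^ n dvd 1 - b * h" using inverse_mod_linear_power[OF assms(1)] .
  have "[:- c, 1:] ^ n dvd (1 - b * h) * g + b * (h * g)"
    by (intro dvd_add dvd_mult2[OF b] dvd_mult[OF assms(2)])
  then show ?thesis by (simp add: algebra_simps)
qed

lemma prod_linear_powers_dvd:
  fixes g :: "'a::field poly"
  assumes "finite J" "inj_on c J" "\<And>j. j \<in> J \<Longrightarrow> [:- c j, 1:] ^ t j dvd g"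
  shows "(\<Prod>j\<in>J. [:- c j, 1:] ^ t j) dvd g"
  using assms
proof (induction J rule: finite_induct)
  case (insert i J)
  let ?P = "\<Prod>j\<in>J. [:- c j, 1:] ^ t j"
  from insert obtain r where r: "g = ?P * r" by (auto simp: inj_on_insert)
  have "poly ?P (c i) \<noteq> 0"
    using insert by (auto simp: poly_prod poly_power inj_on_def)
  moreover have "[:- c i, 1:] ^ t i dvd ?P * r" using insert.prems(2)[of i] r by simp
  ultimately have "[:- c i, 1:] ^ t i dvd r" by (rule linear_power_dvd_mult_cancel)
  then show ?case using insert.hyps r by (simp add: mult.commute mult_dvd_mono)
qed simp

text \<open>
  A square matrix whose minimal polynomial is a product of powers of distinct linear factors.
  A zero exponent is allowed, so that \<open>ev j\<close> need not be an eigenvalue.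
\<close>

locale split_minimal_poly =
  fixes A :: "'a::field mat" and q :: nat and J :: "'i set" and ev :: "'i \<Rightarrow> 'a" and t :: "'i \<Rightarrow> nat"
  assumes A: "A \<in> carrier_mat q q"
    and finite_J: "finite J"
    and inj_ev: "inj_on ev J"
    and minimal: "is_minimal_poly A (\<Prod>j\<in>J. [:- ev j, 1:] ^ t j)"
begin

abbreviation M :: "'a poly \<Rightarrow> 'a mat" where
  "M f \<equiv> poly_mat f A"

lemmas M_carrier [simp] = poly_mat_carrier[OF A]
lemmas dim_A [simp] = carrier_matD[OF A]

lemma M_eq_0_iff: "M f = 0\<^sub>m q q \<longleftrightarrow> (\<forall>j\<in>J. [:- ev j, 1:] ^ t j dvd f)"
proof
  let ?m = "\<Prod>j\<in>J. [:- ev j, 1:] ^ t j"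
  assume "M f = 0\<^sub>m q q"
  then have "?m dvd f" using minimal by (simp add: is_minimal_poly_def)
  then show "\<forall>j\<in>J. [:- ev j, 1:] ^ t j dvd f"
    by (meson dvd_trans dvd_prodI finite_J)
next
  let ?m = "\<Prod>j\<in>J. [:- ev j, 1:] ^ t j"
  assume "\<forall>j\<in>J. [:- ev j, 1:] ^ t j dvd f"
  then obtain k where "f = ?m * k" using prod_linear_powers_dvd[OF finite_J inj_ev] by blast
  moreover have "M ?m = 0\<^sub>m q q" using minimal by (simp add: is_minimal_poly_def)
  ultimately show "M f = 0\<^sub>m q q" by (simp add: poly_mat_mult[OF A])
qed

lemma M_eq_iff: "M f = M g \<longleftrightarrow> (\<forall>j\<in>J. [:- ev j, 1:] ^ t j dvd f - g)"
proof -
  have "M f = M g \<longleftrightarrow> M f - M g = 0\<^sub>m q q"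
  proof
    assume *: "M f - M g = 0\<^sub>m q q"
    show "M f = M g"
    proof (rule eq_matI)
      fix r s assume rs: "r < dim_row (M g)" "s < dim_col (M g)"
      then have "(M f - M g) $$ (r, s) = 0" using * by simp
      then show "M f $$ (r, s) = M g $$ (r, s)" using rs by simp
    qed simp_all
  qed simp
  also have "M f - M g = M (f - g)" by (simp add: poly_mat_diff[OF A])
  finally show ?thesis by (simp add: M_eq_0_iff)
qed

text \<open>
  If every eigenvalue is a root of \<open>f\<close>, then \<open>M f\<close> is nilpotent, with an exponent that does
  not depend on \<open>f\<close>.
\<close>

lemma M_power_eq_0:
  assumes "\<And>j. j \<in> J \<Longrightarrow> t j \<noteq> 0 \<Longrightarrow> poly f (ev j) = 0"
  shows "M f ^\<^sub>m (\<Sum>j\<in>J. t j) = 0\<^sub>m q q"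
proof -
  have "[:- ev j, 1:] ^ t j dvd f ^ (\<Sum>j\<in>J. t j)" if "j \<in> J" for j
  proof (cases "t j = 0")
    case False
    have "[:- ev j, 1:] dvd f" using assms[OF that False] by (simp add: poly_eq_0_iff_dvd)
    moreover have "t j \<le> (\<Sum>j\<in>J. t j)" using that finite_J by (simp add: member_le_sum)
    ultimately show ?thesis by (meson dvd_power_same dvd_trans le_imp_power_dvd)
  qed simp
  then show ?thesis by (simp flip: poly_mat_power[OF A] add: M_eq_0_iff)
qed

section \<open>Spectral idempotents and spectral projections\<close>

text \<open>The product of the other prime powers of the minimal polynomial.\<close>

definition cofactor :: "'i \<Rightarrow> 'a poly" where
  "cofactor j = (\<Prod>i\<in>J - {j}. [:- ev i, 1:] ^ t i)"

text \<open>
  The idempotent of the Chinese remainder theorem: for \<open>j \<in> J\<close> it is \<open>1\<close> modulo \<open>(X - ev j) ^ t j\<close> and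
  \<open>0\<close> modulo the other prime powers. With \<open>h\<close> the cofactor and \<open>u = 1 - h / h (ev j)\<close>, the first holds
  for \<open>1 - u ^ t j\<close> because \<open>X - ev j\<close> divides \<open>u\<close>, the second because \<open>h\<close> divides \<open>1 - u\<close>.
\<close>

definition idem :: "'i \<Rightarrow> 'a poly" where
  "idem j = 1 - (1 - Polynomial.smult (1 / poly (cofactor j) (ev j)) (cofactor j)) ^ t j"

lemma poly_cofactor_nonzero: "j \<in> J \<Longrightarrow> poly (cofactor j) (ev j) \<noteq> 0"
  using inj_ev finite_J by (auto simp: cofactor_def poly_prod poly_power inj_on_def)

lemma idem_cong_1: "j \<in> J \<Longrightarrow> [:- ev j, 1:] ^ t j dvd 1 - idem j"
  using linear_power_dvd_one_minus_power[OF poly_cofactor_nonzero] by (simp add: idem_def)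

lemma idem_cong_0: 
  assumes "i \<in> J" "i \<noteq> j"
  shows "[:- ev i, 1:] ^ t i dvd idem j"
proof -
  define u where "u = 1 - Polynomial.smult (1 / poly (cofactor j) (ev j)) (cofactor j)"
  have "[:- ev i, 1:] ^ t i dvd cofactor j"
    unfolding cofactor_def using assms finite_J by (intro dvd_prodI) auto
  then have "[:- ev i, 1:] ^ t i dvd 1 - u" by (simp add: u_def dvd_smult)
  also have "1 - u dvd 1 - u ^ t j"
    using power_diff_sumr2[of 1 "t j" u] by simp
  finally show ?thesis by (simp add: idem_def u_def)
qed

lemma poly_idem:
  assumes "i \<in> J" "j \<in> J" "t i \<noteq> 0"
  shows "poly (idem j) (ev i) = (if i = j then 1 else 0)"
proof -
  have "[:- ev i, 1:] dvd [:- ev i, 1:] ^ t i" using assms(3) by (simp add: dvd_power)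
  then have "[:- ev i, 1:] dvd (if i = j then 1 - idem j else idem j)"
    using idem_cong_1[of i] idem_cong_0[of i j] assms by (auto intro: dvd_trans)
  then show ?thesis by (auto simp: dvd_iff_poly_eq_0 split: if_splits)
qed

lemma idem_sum_cong_1:
  assumes "i \<in> J"
  shows "[:- ev i, 1:] ^ t i dvd 1 - (\<Sum>j\<in>J. idem j)"
proof -
  have "1 - (\<Sum>j\<in>J. idem j) = (1 - idem i) - (\<Sum>j\<in>J - {i}. idem j)"
    using assms finite_J by (simp add: sum.remove)
  moreover have "[:- ev i, 1:] ^ t i dvd (\<Sum>j\<in>J - {i}. idem j)"
    using assms idem_cong_0 by (intro dvd_sum) auto
  ultimately show ?thesis using idem_cong_1[OF assms] by (metis dvd_diff)
qed

lemma M_sum_idem: "M (\<Sum>j\<in>J. idem j) = 1\<^sub>m q"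
proof -
  have "M (\<Sum>j\<in>J. idem j) = M 1"
    unfolding M_eq_iff using idem_sum_cong_1 by (metis dvd_minus_iff minus_diff_eq)
  then show ?thesis by (simp add: poly_mat_1[OF A])
qed

lemma M_idem_mult_eq_0_iff:
  assumes "j \<in> J"
  shows "M (f * idem j) = 0\<^sub>m q q \<longleftrightarrow> [:- ev j, 1:] ^ t j dvd f"
proof
  assume "M (f * idem j) = 0\<^sub>m q q"
  then have "[:- ev j, 1:] ^ t j dvd f * idem j" using assms by (simp add: M_eq_0_iff)
  then have "[:- ev j, 1:] ^ t j dvd f * idem j + f * (1 - idem j)"
    using idem_cong_1[OF assms] by (intro dvd_add) auto
  then show "[:- ev j, 1:] ^ t j dvd f" by (simp add: algebra_simps)
next
  assume f: "[:- ev j, 1:] ^ t j dvd f"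
  have "[:- ev i, 1:] ^ t i dvd f * idem j" if "i \<in> J" for i
    using f idem_cong_0[of i j] that by (cases "i = j") auto
  then show "M (f * idem j) = 0\<^sub>m q q" by (simp add: M_eq_0_iff)
qed

lemma M_idem_mult:
  assumes "i \<in> J" "j \<in> J"
  shows "M (idem i * idem j) = (if i = j then M (idem j) else 0\<^sub>m q q)"
proof (cases "i = j")
  case True
  have "M (idem j * idem j) = M (idem j)"
  proof -
    have "M ((idem j - 1) * idem j) = 0\<^sub>m q q"
      using idem_cong_1[OF assms(2)] dvd_diff_commute unfolding M_idem_mult_eq_0_iff[OF assms(2)] by blast
    moreover have "(idem j - 1) * idem j = idem j * idem j - idem j" by (simp add: algebra_simps)
    ultimately show ?thesis by (simp add: M_eq_iff M_eq_0_iff)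
  qed
  with True show ?thesis by simp
next
  case False
  then show ?thesis using idem_cong_0[of j i] assms by (simp add: M_idem_mult_eq_0_iff)
qed

lemma M_idem_vec_sum:
  assumes "v \<in> carrier_vec q" "r < q"
  shows "v $ r = (\<Sum>j\<in>J. (M (idem j) *\<^sub>v v) $ r)"
proof -
  have "v = mat_sum q (\<lambda>j. M (idem j)) J *\<^sub>v v"
    using assms M_sum_idem by (simp add: poly_mat_sum[OF A])
  then show ?thesis using index_mult_mat_vec_mat_sum[of J "\<lambda>j. M (idem j)" q v r] assms by simp
qed

lemma M_mult_vec:
  "v \<in> carrier_vec q \<Longrightarrow> M (f * g) *\<^sub>v v = M f *\<^sub>v (M g *\<^sub>v v)"
  by (simp add: poly_mat_mult[OF A] assoc_mult_mat_vec[of _ q q _ q])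

lemma M_mult_0_vec: "M f *\<^sub>v 0\<^sub>v q = 0\<^sub>v q"
  by (rule eq_vecI) auto

lemma zero_mat_mult_vec: "v \<in> carrier_vec q \<Longrightarrow> 0\<^sub>m q q *\<^sub>v v = 0\<^sub>v q"
  by auto

lemma gen_eigenspace_eq: "gen_eigenspace A (ev j) (t j) = mat_kernel (M ([:- ev j, 1:] ^ t j))"
  by (simp add: gen_eigenspace_def poly_mat_power[OF A] poly_mat_linear[OF A])

lemma image_M_idem:
  assumes "j \<in> J"
  shows "(\<lambda>v. M (idem j) *\<^sub>v v) ` carrier_vec q = gen_eigenspace A (ev j) (t j)"
proof (intro equalityI subsetI)
  let ?f = "[:- ev j, 1:] ^ t j"
  fix w assume "w \<in> (\<lambda>v. M (idem j) *\<^sub>v v) ` carrier_vec q"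
  then obtain v where v: "v \<in> carrier_vec q" "w = M (idem j) *\<^sub>v v" by blast
  have "M ?f *\<^sub>v w = M (?f * idem j) *\<^sub>v v" using v by (simp add: M_mult_vec)
  also have "\<dots> = 0\<^sub>v q" using assms v(1) M_idem_mult_eq_0_iff[of j ?f] by (simp add: zero_mat_mult_vec)
  finally show "w \<in> gen_eigenspace A (ev j) (t j)"
    using v by (simp add: gen_eigenspace_eq mat_kernelI[of _ q q] mult_mat_vec_carrier[of _ q q])
next
  let ?f = "[:- ev j, 1:] ^ t j"
  fix w assume "w \<in> gen_eigenspace A (ev j) (t j)"
  then have w: "w \<in> carrier_vec q" "M ?f *\<^sub>v w = 0\<^sub>v q"
    by (auto simp: gen_eigenspace_eq dest: mat_kernelD[of _ q q, OF M_carrier])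
  obtain k where k: "1 - idem j = k * ?f" using idem_cong_1[OF assms] by (metis dvd_def mult.commute)
  have "w - M (idem j) *\<^sub>v w = M (k * ?f) *\<^sub>v w"
    using w(1) unfolding k[symmetric] poly_mat_diff[OF A] poly_mat_1[OF A]
    by (simp add: minus_mult_distrib_mat_vec[of _ q q])
  also have "\<dots> = 0\<^sub>v q" using w by (simp add: M_mult_vec M_mult_0_vec)
  finally have "w - M (idem j) *\<^sub>v w = 0\<^sub>v q" .
  then have "w = M (idem j) *\<^sub>v w"
    using w(1) by (simp add: vec_eq_iff)
  then show "w \<in> (\<lambda>v. M (idem j) *\<^sub>v v) ` carrier_vec q" using w(1) by blast
qed

end

lemma is_projection_along_unique:
  assumes "is_projection_along q U W P" "is_projection_along q U W P'"
  shows "P = P'"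
proof -
  have P: "P \<in> carrier_mat q q" "P * P = P" "(\<lambda>v. P *\<^sub>v v) ` carrier_vec q = U" "mat_kernel P = W"
    and P': "P' \<in> carrier_mat q q" "P' * P' = P'" "(\<lambda>v. P' *\<^sub>v v) ` carrier_vec q = U" "mat_kernel P' = W"
    using assms by (simp_all add: is_projection_along_def)
  have eq: "P *\<^sub>v v = P' *\<^sub>v v" if v: "v \<in> carrier_vec q" for v
  proof -
    have Pv: "P *\<^sub>v v \<in> carrier_vec q" using P(1) v by auto
    have "P *\<^sub>v (P *\<^sub>v v) = P *\<^sub>v v"
      using P(1,2) v by (simp flip: assoc_mult_mat_vec)
    then have "P *\<^sub>v (v - P *\<^sub>v v) = 0\<^sub>v q"
      using P(1) v Pv by (simp add: mult_minus_distrib_mat_vec)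
    then have "v - P *\<^sub>v v \<in> mat_kernel P'"
      using P(1,4) P'(4) v Pv by (metis mat_kernelI minus_carrier_vec)
    then have "P' *\<^sub>v (v - P *\<^sub>v v) = 0\<^sub>v q" using P'(1) by (rule mat_kernelD(2)[rotated])
    then have 1: "P' *\<^sub>v v - P' *\<^sub>v (P *\<^sub>v v) = 0\<^sub>v q"
      using P'(1) v Pv by (simp add: mult_minus_distrib_mat_vec)
    have "P *\<^sub>v v \<in> (\<lambda>v. P' *\<^sub>v v) ` carrier_vec q" using P(3) P'(3) v by auto
    then obtain u where u: "u \<in> carrier_vec q" "P *\<^sub>v v = P' *\<^sub>v u" by blast
    have "P' *\<^sub>v (P *\<^sub>v v) = P *\<^sub>v v"
      using P'(1,2) u by (simp flip: assoc_mult_mat_vec)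
    then have "P' *\<^sub>v v - P *\<^sub>v v = 0\<^sub>v q" using 1 by simp
    then show ?thesis using P(1) P'(1) v by (simp add: vec_eq_iff)
  qed
  show ?thesis
  proof (rule eq_matI)
    fix r s assume "r < dim_row P'" "s < dim_col P'"
    then have rs: "r < q" "s < q" using P'(1) by simp_all
    have "(P *\<^sub>v unit_vec q s) $ r = (P' *\<^sub>v unit_vec q s) $ r" by (simp add: eq)
    then show "P $$ (r, s) = P' $$ (r, s)" using rs P(1) P'(1) by simp
  qed (use P(1) P'(1) in auto)
qed

lemma projection_along_eq: "is_projection_along q U W P \<Longrightarrow> projection_along q U W = P"
  unfolding projection_along_def by (blast intro: is_projection_along_unique)

context split_minimal_poly
begin

lemma kernel_M_idem:
  assumes j: "j \<in> J"
  shows "mat_kernel (M (idem j)) = sum_of_subspaces q (\<lambda>i. gen_eigenspace A (ev i) (t i)) (J - {j})"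
proof (intro equalityI subsetI)
  fix v assume "v \<in> mat_kernel (M (idem j))"
  then have v: "v \<in> carrier_vec q" "M (idem j) *\<^sub>v v = 0\<^sub>v q"
    by (auto dest: mat_kernelD[of _ q q, OF M_carrier])
  let ?w = "\<lambda>i. M (idem i) *\<^sub>v v"
  have "v = finsum_vec TYPE('a) q ?w (J - {j})"
  proof (rule eq_vecI)
    have c: "?w \<in> J - {j} \<rightarrow> carrier_vec q" using v by (auto intro: mult_mat_vec_carrier[of _ q q])
    fix r assume "r < dim_vec (finsum_vec TYPE('a) q ?w (J - {j}))"
    then have r: "r < q" using finsum_vec_closed[OF c] by simp
    have "v $ r = (\<Sum>i\<in>J. ?w i $ r)" using M_idem_vec_sum[OF v(1) r] .
    also have "\<dots> = (\<Sum>i\<in>J - {j}. ?w i $ r)" using v(2) r j finite_J by (simp add: sum.remove del: index_mult_mat_vec)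
    also have "\<dots> = finsum_vec TYPE('a) q ?w (J - {j}) $ r"
      using c r finite_J by (simp add: index_finsum_vec)
    finally show "v $ r = finsum_vec TYPE('a) q ?w (J - {j}) $ r" .
  next
    have c: "?w \<in> J - {j} \<rightarrow> carrier_vec q" using v by (auto intro: mult_mat_vec_carrier[of _ q q])
    show "dim_vec v = dim_vec (finsum_vec TYPE('a) q ?w (J - {j}))"
      using finsum_vec_closed[OF c] v by simp
  qed
  moreover have "\<forall>i\<in>J - {j}. ?w i \<in> gen_eigenspace A (ev i) (t i)"
    using image_M_idem v(1) by blast
  ultimately show "v \<in> sum_of_subspaces q (\<lambda>i. gen_eigenspace A (ev i) (t i)) (J - {j})"
    unfolding sum_of_subspaces_def by blast
next
  fix v assume "v \<in> sum_of_subspaces q (\<lambda>i. gen_eigenspace A (ev i) (t i)) (J - {j})"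
  then obtain w where w: "\<forall>i\<in>J - {j}. w i \<in> gen_eigenspace A (ev i) (t i)"
    and v: "v = finsum_vec TYPE('a) q w (J - {j})"
    unfolding sum_of_subspaces_def by blast
  have "\<forall>i\<in>J - {j}. \<exists>u\<in>carrier_vec q. w i = M (idem i) *\<^sub>v u"
    using w image_M_idem by blast
  then obtain u where u: "\<And>i. i \<in> J - {j} \<Longrightarrow> u i \<in> carrier_vec q \<and> w i = M (idem i) *\<^sub>v u i"
    by metis
  have w0: "w i \<in> carrier_vec q" "M (idem j) *\<^sub>v w i = 0\<^sub>v q" if "i \<in> J - {j}" for i
  proof -
    show "w i \<in> carrier_vec q" using u[OF that] by (auto intro: mult_mat_vec_carrier[of _ q q])
    have "M (idem j) *\<^sub>v w i = M (idem j * idem i) *\<^sub>v u i" using u[OF that] by (simp add: M_mult_vec)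
    also have "\<dots> = 0\<^sub>v q" using u[OF that] that j M_idem_mult[of j i] by (auto simp: zero_mat_mult_vec)
    finally show "M (idem j) *\<^sub>v w i = 0\<^sub>v q" .
  qed
  have "M (idem j) *\<^sub>v finsum_vec TYPE('a) q w K = 0\<^sub>v q \<and> finsum_vec TYPE('a) q w K \<in> carrier_vec q"
    if "finite K" "K \<subseteq> J - {j}" for K
    using that
  proof (induction K)
    case empty
    then show ?case by (simp add: finsum_vec_empty M_mult_0_vec)
  next
    case (insert i K)
    then have c: "w \<in> K \<rightarrow> carrier_vec q" "w i \<in> carrier_vec q" using w0(1) by auto
    then have "finsum_vec TYPE('a) q w (insert i K) = w i + finsum_vec TYPE('a) q w K"
      using insert.hyps by (simp add: finsum_vec_insert)
    then show ?case using insert c w0(2)[of i]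
      by (simp add: mult_add_distrib_mat_vec[of _ q q])
  qed
  from this[of "J - {j}"] show "v \<in> mat_kernel (M (idem j))"
    using finite_J v by (intro mat_kernelI[of _ q q]) auto
qed

theorem spectral_projection_eq:
  assumes "j \<in> J"
  shows "spectral_projection A J ev t j = M (idem j)"
  unfolding spectral_projection_def
proof (rule projection_along_eq)
  have "M (idem j) * M (idem j) = M (idem j)"
    using M_idem_mult[of j j] assms by (simp add: poly_mat_mult[OF A])
  then show "is_projection_along (dim_row A) (gen_eigenspace A (ev j) (t j))
     (sum_of_subspaces (dim_row A) (\<lambda>i. gen_eigenspace A (ev i) (t i)) (J - {j})) (M (idem j))"
    using assms by (simp add: is_projection_along_def image_M_idem kernel_M_idem)
qed

end

section \<open>Simultaneous diagonalization of orthogonal idempotents\<close>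

lemma (in vec_space) basis_in_spanning_set:
  assumes fin: "finite G" and G: "G \<subseteq> carrier_vec n" and units: "set (unit_vecs n) \<subseteq> span G"
  obtains bs where "set bs \<subseteq> G" "distinct bs" "length bs = n" "lin_indpt (set bs)"
proof -
  let ?P = "\<lambda>T. T \<subseteq> G \<and> lin_indpt T"
  have "lin_indpt {}" by (auto simp: lin_dep_def)
  then obtain S where S: "maximal S ?P" 
    using maximal_exists_superset[of G ?P "{}"] fin by blast
  then have SG: "S \<subseteq> G" and li: "lin_indpt S" by (auto simp: maximal_def)
  have finS: "finite S" using SG fin by (rule finite_subset)
  have Sc: "S \<subseteq> carrier_vec n" using SG G by blast
  have "G \<subseteq> span S"
  proof
    fix g assume g: "g \<in> G"
    show "g \<in> span S"
    proof (rule ccontr)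
      assume gS: "g \<notin> span S"
      then have "g \<notin> S" using span_mem[OF Sc] by blast
      then have "lin_indpt (S \<union> {g})" using lin_dep_iff_in_span[OF Sc li _ \<open>g \<notin> S\<close>] g G gS by blast
      then show False using S g SG \<open>g \<notin> S\<close> unfolding maximal_def by blast
    qed
  qed
  then have "span G \<subseteq> span S" by (rule span_is_subset[OF _ span_is_submodule[OF Sc]])
  then have "span (set (unit_vecs n)) \<subseteq> span S"
    using units by (intro span_is_subset[OF _ span_is_submodule[OF Sc]]) blast
  then have "span S = carrier_vec n"
    using span_is_subset2[OF Sc] unfolding span_unit_vecs_is_carrier by blast
  then have "basis S" using li Sc by (simp add: basis_def)
  then have "card S = n" using dim_basis[OF finS] dim_is_n by simp
  moreover obtain bs where "set bs = S" "distinct bs" using finite_distinct_list[OF finS] by blast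
  ultimately show ?thesis using that[of bs] SG li distinct_card[of bs] by simp
qed

text \<open>
  The images of the idempotents together span the space, so a basis can be chosen among their
  vectors.
\<close>

lemma orthogonal_idempotents_diagonalizable:
  fixes E :: "'i \<Rightarrow> 'a::field mat"
  assumes J: "finite J" and E: "\<And>j. j \<in> J \<Longrightarrow> E j \<in> carrier_mat q q"
    and mult: "\<And>i j. i \<in> J \<Longrightarrow> j \<in> J \<Longrightarrow> E i * E j = (if i = j then E j else 0\<^sub>m q q)"
    and sum: "mat_sum q E J = 1\<^sub>m q"
  obtains P Q where "P \<in> carrier_mat q q" "Q \<in> carrier_mat q q" "P * Q = 1\<^sub>m q" "Q * P = 1\<^sub>m q"
    "\<And>c. c < q \<Longrightarrow> \<exists>j\<in>J. \<forall>i\<in>J. E i *\<^sub>v col P c = (if i = j then col P c else 0\<^sub>v q)"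
proof -
  interpret vec_space "TYPE('a)" q .
  let ?G = "(\<lambda>(j, r). E j *\<^sub>v unit_vec q r) ` (J \<times> {..<q})"
  have fin: "finite ?G" using J by simp
  have G: "?G \<subseteq> carrier_vec q" using E by (auto intro: mult_mat_vec_carrier[of _ q q])
  have "set (unit_vecs q) \<subseteq> span ?G"
  proof
    fix v :: "'a vec" assume "v \<in> set (unit_vecs q)"
    then obtain r where r: "r < q" "v = unit_vec q r" by (auto simp: unit_vecs_def)
    have "mat_sum q E K *\<^sub>v v \<in> span ?G" if "finite K" "K \<subseteq> J" for K
      using that
    proof (induction K)
      case empty
      have "0\<^sub>m q q *\<^sub>v v = 0\<^sub>v q" using r by auto
      then show ?case using span_empty span_is_monotone[of "{}" ?G] by (simp add: mat_sum_empty)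
    next
      case (insert j K)
      then have j: "j \<in> J" by blast
      have "mat_sum q E (insert j K) *\<^sub>v v = E j *\<^sub>v v + mat_sum q E K *\<^sub>v v"
        using insert.hyps E[OF j] r by (simp add: mat_sum_insert add_mult_distrib_mat_vec[of _ q q])
      moreover have "E j *\<^sub>v v \<in> span ?G" using j r by (intro span_mem[OF G]) auto
      ultimately show ?case using insert G span_add1[of ?G] by simp
    qed
    from this[OF J] show "v \<in> span ?G" using sum r by simp
  qed
  then obtain bs where bs: "set bs \<subseteq> ?G" "distinct bs" "length bs = q" "lin_indpt (set bs)"
    using basis_in_spanning_set[OF fin G] by blast
  let ?P = "mat_of_cols q bs"
  have bsc: "set bs \<subseteq> carrier_vec q" using bs(1) G by blast
  have P: "?P \<in> carrier_mat q q" using mat_of_cols_carrier(1)[of q bs] bs(3) by simp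
  have "rank ?P = q" using lin_indpt_full_rank[OF P] bs bsc by simp
  then have "det ?P \<noteq> 0" using det_rank_iff[OF P] by simp
  then have "?P \<in> Units (ring_mat TYPE('a) q ())" by (rule det_non_zero_imp_unit[OF P])
  then obtain Q where Q: "Q \<in> carrier_mat q q" "?P * Q = 1\<^sub>m q" "Q * ?P = 1\<^sub>m q"
    by (auto simp: Units_def ring_mat_def)
  have "\<exists>j\<in>J. \<forall>i\<in>J. E i *\<^sub>v col ?P c = (if i = j then col ?P c else 0\<^sub>v q)" if c: "c < q" for c
  proof -
    have "col ?P c = bs ! c" using c bs bsc by (intro col_mat_of_cols) (auto simp: subset_iff)
    moreover have "bs ! c \<in> ?G" using bs(1,3) c by (auto simp: subset_iff)
    ultimately obtain j r where j: "j \<in> J" "r < q" "col ?P c = E j *\<^sub>v unit_vec q r" by auto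
    have "E i *\<^sub>v col ?P c = (if i = j then col ?P c else 0\<^sub>v q)" if i: "i \<in> J" for i
    proof -
      have "E i *\<^sub>v col ?P c = (E i * E j) *\<^sub>v unit_vec q r"
        using E[OF i] E[OF j(1)] by (simp add: j(3))
      then show ?thesis using mult[OF i j(1)] j(3) by auto
    qed
    with j(1) show ?thesis by blast
  qed
  with P Q show ?thesis using that by blast
qed

section \<open>The semisimple part\<close>

context split_minimal_poly
begin

text \<open>
  \<open>M (semisimple g)\<close> is the semisimple part of \<open>M g\<close>. It acts on the generalized eigenspace of \<open>ev j\<close> as multiplication by
  \<open>g (ev j)\<close>.
\<close>

definition semisimple :: "'a poly \<Rightarrow> 'a poly" where
  "semisimple g = (\<Sum>j\<in>J. Polynomial.smult (poly g (ev j)) (idem j))"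

lemma poly_semisimple:
  assumes "i \<in> J" "t i \<noteq> 0"
  shows "poly (semisimple g) (ev i) = poly g (ev i)"
proof -
  have "poly (semisimple g) (ev i) = (\<Sum>j\<in>J. poly g (ev j) * (if i = j then 1 else 0))"
    using assms by (simp add: semisimple_def poly_sum poly_idem cong: sum.cong)
  then show ?thesis using assms(1) finite_J by (simp add: if_distrib cong: if_cong)
qed

lemma M_semisimple_mult_vec:
  assumes v: "v \<in> carrier_vec q"
    and d: "\<And>j. j \<in> J \<Longrightarrow> poly g (ev j) = d \<or> M (idem j) *\<^sub>v v = 0\<^sub>v q"
  shows "M (semisimple g) *\<^sub>v v = d \<cdot>\<^sub>v v"
proof (rule eq_vecI)
  fix r assume "r < dim_vec (d \<cdot>\<^sub>v v)"
  then have r: "r < q" using v by simp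
  have "M (semisimple g) = mat_sum q (\<lambda>j. poly g (ev j) \<cdot>\<^sub>m M (idem j)) J"
    by (simp add: semisimple_def poly_mat_sum[OF A] poly_mat_smult[OF A])
  then have "(M (semisimple g) *\<^sub>v v) $ r = (\<Sum>j\<in>J. ((poly g (ev j) \<cdot>\<^sub>m M (idem j)) *\<^sub>v v) $ r)"
    using index_mult_mat_vec_mat_sum[OF _ v r, of J "\<lambda>j. poly g (ev j) \<cdot>\<^sub>m M (idem j)"] by simp
  also have "\<dots> = (\<Sum>j\<in>J. d * (M (idem j) *\<^sub>v v) $ r)"
  proof (intro sum.cong refl)
    fix j assume j: "j \<in> J"
    have "((poly g (ev j) \<cdot>\<^sub>m M (idem j)) *\<^sub>v v) $ r = poly g (ev j) * (M (idem j) *\<^sub>v v) $ r"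
      using v r by (simp add: scalar_prod_def sum_distrib_left mult_ac)
    moreover have "(M (idem j) *\<^sub>v v) $ r = 0" if "M (idem j) *\<^sub>v v = 0\<^sub>v q" using that r by (metis index_zero_vec(1))
    ultimately show "((poly g (ev j) \<cdot>\<^sub>m M (idem j)) *\<^sub>v v) $ r = d * (M (idem j) *\<^sub>v v) $ r"
      using d[OF j] by auto
  qed
  also have "\<dots> = d * v $ r" by (simp only: sum_distrib_left[symmetric] M_idem_vec_sum[OF v r])
  finally show "(M (semisimple g) *\<^sub>v v) $ r = (d \<cdot>\<^sub>v v) $ r" using v r by simp
qed (use v in simp)

text \<open>
  On the \<open>d\<close>-eigenspace of \<open>C\<close>, which \<open>B\<close> preserves, \<open>M g - d\<close> acts as the nilpotent \<open>B\<close>, so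
  \<open>(M g - d) ^ n\<close> kills \<open>v\<close>. If \<open>g (ev j) \<noteq> d\<close>, then \<open>(g - d) ^ n\<close> is invertible modulo
  \<open>(X - ev j) ^ t j\<close>, and hence the \<open>j\<close>th component of \<open>v\<close> is \<open>0\<close>.
\<close>

lemma semisimple_eigenvector:
  assumes B: "B \<in> carrier_mat q q" and C: "C \<in> carrier_mat q q" and sum: "M g = B + C"
    and comm: "B * C = C * B" and nil: "B ^\<^sub>m n = 0\<^sub>m q q"
    and v: "v \<in> carrier_vec q" "C *\<^sub>v v = d \<cdot>\<^sub>v v"
  shows "M (semisimple g) *\<^sub>v v = d \<cdot>\<^sub>v v"
proof (rule M_semisimple_mult_vec[OF v(1)])
  let ?h = "g - [:d:]"
  have Mh: "M ?h *\<^sub>v w = B *\<^sub>v w + (C *\<^sub>v w - d \<cdot>\<^sub>v w)" if w: "w \<in> carrier_vec q" for w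
  proof -
    have "[:d:] = Polynomial.smult d 1" by simp
    then have "M ?h = B + C - d \<cdot>\<^sub>m 1\<^sub>m q"
      by (simp only: poly_mat_diff[OF A] sum poly_mat_smult[OF A] poly_mat_1[OF A])
    moreover have "(d \<cdot>\<^sub>m 1\<^sub>m q) *\<^sub>v w = d \<cdot>\<^sub>v w"
      using w by (intro eq_vecI) simp_all
    ultimately have "M ?h *\<^sub>v w = B *\<^sub>v w + C *\<^sub>v w - d \<cdot>\<^sub>v w"
      using B C w by (simp add: minus_mult_distrib_mat_vec[of _ q q] add_mult_distrib_mat_vec[of _ q q])
    then show ?thesis using B C w by (intro eq_vecI) (auto simp: algebra_simps)
  qed
  have step: "M (?h ^ i) *\<^sub>v v = B ^\<^sub>m i *\<^sub>v v \<and> C *\<^sub>v (B ^\<^sub>m i *\<^sub>v v) = d \<cdot>\<^sub>v (B ^\<^sub>m i *\<^sub>v v)" for i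
  proof (induction i)
    case 0
    show ?case using B v by (simp add: poly_mat_1[OF A])
  next
    case (Suc i)
    let ?w = "B ^\<^sub>m i *\<^sub>v v"
    have Bi: "B ^\<^sub>m i \<in> carrier_mat q q" using B by (rule pow_carrier_mat)
    then have w: "?w \<in> carrier_vec q" using v by auto
    have Bw: "B ^\<^sub>m Suc i *\<^sub>v v = B *\<^sub>v ?w"
      using B Bi v by (simp add: pow_mat_Suc_left[OF B] assoc_mult_mat_vec[of _ q q _ q] del: pow_mat.simps)
    have "M (?h ^ Suc i) *\<^sub>v v = M ?h *\<^sub>v ?w" using Suc v by (simp add: M_mult_vec)
    also have "\<dots> = B *\<^sub>v ?w" using Mh[OF w] Suc w B by auto
    finally have 1: "M (?h ^ Suc i) *\<^sub>v v = B ^\<^sub>m Suc i *\<^sub>v v" by (simp only: Bw)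
    have "C *\<^sub>v (B *\<^sub>v ?w) = (B * C) *\<^sub>v ?w" using B C w comm by simp
    also have "\<dots> = B *\<^sub>v (C *\<^sub>v ?w)" using B C w by simp
    also have "\<dots> = d \<cdot>\<^sub>v (B *\<^sub>v ?w)" using Suc B w by (simp add: mult_mat_vec)
    finally show ?case using 1 by (simp only: Bw)
  qed
  fix j assume j: "j \<in> J"
  show "poly g (ev j) = d \<or> M (idem j) *\<^sub>v v = 0\<^sub>v q"
  proof (cases "poly g (ev j) = d")
    case False
    then have "poly (?h ^ n) (ev j) \<noteq> 0" by simp
    then obtain b where b: "[:- ev j, 1:] ^ t j dvd 1 - b * ?h ^ n" using inverse_mod_linear_power by blast
    have "M ((1 - b * ?h ^ n) * idem j) = 0\<^sub>m q q" using b j by (simp add: M_idem_mult_eq_0_iff)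
    moreover have "idem j = (1 - b * ?h ^ n) * idem j + b * idem j * ?h ^ n" by (simp add: algebra_simps)
    ultimately have "M (idem j) = M (b * idem j * ?h ^ n)"
      by (metis M_carrier left_add_zero_mat poly_mat_add[OF A])
    then have "M (idem j) *\<^sub>v v = M (b * idem j) *\<^sub>v (M (?h ^ n) *\<^sub>v v)" using v by (simp add: M_mult_vec)
    then have "M (idem j) *\<^sub>v v = 0\<^sub>v q"
      using step[of n] nil v by (simp add: zero_mat_mult_vec M_mult_0_vec)
    then show ?thesis ..
  qed simp
qed

text \<open>Uniqueness in the Jordan-Chevalley decomposition of \<open>M g\<close>.\<close>

lemma semisimple_unique:
  assumes B: "B \<in> carrier_mat q q" and C: "C \<in> carrier_mat q q" and sum: "M g = B + C"
    and comm: "B * C = C * B" and nil: "B ^\<^sub>m n = 0\<^sub>m q q"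
    and diag: "C = P * D * Q" "P \<in> carrier_mat q q" "Q \<in> carrier_mat q q" "P * Q = 1\<^sub>m q" "Q * P = 1\<^sub>m q"
      "D \<in> carrier_mat q q" "diagonal_mat D"
  shows "C = M (semisimple g)"
proof -
  have "C * P = P * D * (Q * P)"
    unfolding diag(1) by (rule assoc_mult_mat[OF mult_carrier_mat[OF diag(2,6)] diag(3,2)])
  then have CP: "C * P = P * D" using diag(2,5,6) by simp
  have "M (semisimple g) = P * D * Q"
  proof (rule diagonalization_by_columns[OF _ diag(2,3,4,6,7)])
    fix c assume c: "c < q"
    have "C *\<^sub>v col P c = D $$ (c, c) \<cdot>\<^sub>v col P c"
      using C diag(2,6,7) c CP by (metis col_mult2 col_mult_diagonal_mat)
    then show "M (semisimple g) *\<^sub>v col P c = D $$ (c, c) \<cdot>\<^sub>v col P c"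
      using diag(2) c by (intro semisimple_eigenvector[OF B C sum comm nil]) auto
  qed simp
  then show ?thesis using diag(1) by simp
qed

text \<open>
  One basis diagonalizes the semisimple parts of all polynomials in \<open>A\<close>. Its \<open>r\<close>th vector lies in the
  generalized eigenspace of \<open>ev (f r)\<close>.
\<close>

lemma semisimple_diagonalization:
  obtains P Q f where "P \<in> carrier_mat q q" "Q \<in> carrier_mat q q" "P * Q = 1\<^sub>m q" "Q * P = 1\<^sub>m q"
    "\<And>g. M (semisimple g) = P * mat q q (\<lambda>(r, s). if r = s then poly g (ev (f r)) else 0) * Q"
proof -
  have sum: "mat_sum q (\<lambda>j. M (idem j)) J = 1\<^sub>m q" using M_sum_idem by (simp add: poly_mat_sum[OF A])
  obtain P Q where PQ: "P \<in> carrier_mat q q" "Q \<in> carrier_mat q q" "P * Q = 1\<^sub>m q" "Q * P = 1\<^sub>m q"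
    and ex: "\<And>c. c < q \<Longrightarrow> \<exists>j\<in>J. \<forall>i\<in>J. M (idem i) *\<^sub>v col P c = (if i = j then col P c else 0\<^sub>v q)"
    using orthogonal_idempotents_diagonalizable[OF finite_J _ _ sum] M_idem_mult
    by (auto simp: poly_mat_mult[OF A])
  then obtain f where f: "\<And>c i. c < q \<Longrightarrow> f c \<in> J \<and> (i \<in> J \<longrightarrow> M (idem i) *\<^sub>v col P c = (if i = f c then col P c else 0\<^sub>v q))"
    by metis
  have "M (semisimple g) = P * mat q q (\<lambda>(r, s). if r = s then poly g (ev (f r)) else 0) * Q" for g
  proof (rule diagonalization_by_columns[OF _ PQ(1,2,3)])
    fix c assume c: "c < q"
    have "M (semisimple g) *\<^sub>v col P c = poly g (ev (f c)) \<cdot>\<^sub>v col P c"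
    proof (rule M_semisimple_mult_vec)
      fix j assume "j \<in> J"
      then show "poly g (ev j) = poly g (ev (f c)) \<or> M (idem j) *\<^sub>v col P c = 0\<^sub>v q"
        using f[OF c] by (cases "j = f c") auto
    qed (use PQ(1) c in auto)
    then show "M (semisimple g) *\<^sub>v col P c
        = mat q q (\<lambda>(r, s). if r = s then poly g (ev (f r)) else 0) $$ (c, c) \<cdot>\<^sub>v col P c"
      using c by simp
  qed (auto simp: diagonal_mat_def)
  with PQ show ?thesis using that by blast
qed

end

section \<open>Linear independence of the sequences in the canonical form\<close>

text \<open>The bilinear pairing of polynomials with sequences for which \<open>X ^ k\<close> picks the \<open>k\<close>th term.\<close>

definition pairing :: "'a::field poly \<Rightarrow> (nat \<Rightarrow> 'a) \<Rightarrow> 'a" where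
  "pairing f s = (\<Sum>k\<le>degree f. coeff f k * s k)"

lemma coeff_linear_power_shift:
  fixes c :: "'a::field"
  shows "coeff ([:c, 1:] ^ k) i * c ^ i = of_nat (k choose i) * c ^ k"
proof (induction k arbitrary: i)
  case 0
  then show ?case by (cases i) auto
next
  case (Suc k)
  show ?case
  proof (cases i)
    case 0
    have "coeff ([:c, 1:] ^ Suc k) 0 = c * coeff ([:c, 1:] ^ k) 0" by simp
    then show ?thesis using 0 Suc[of 0] by simp
  next
    case (Suc i')
    have "coeff ([:c, 1:] ^ Suc k) i = c * coeff ([:c, 1:] ^ k) i + coeff ([:c, 1:] ^ k) i'"
      using Suc by simp
    then have "coeff ([:c, 1:] ^ Suc k) i * c ^ i
        = c * (coeff ([:c, 1:] ^ k) i * c ^ i) + c * (coeff ([:c, 1:] ^ k) i' * c ^ i')"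
      using Suc by (simp add: algebra_simps)
    also have "\<dots> = c * (of_nat (k choose i) * c ^ k) + c * (of_nat (k choose i') * c ^ k)"
      unfolding Suc.IH ..
    finally show ?thesis using Suc by (simp add: algebra_simps)
  qed
qed

lemma pcompose_power: "(f ^ n) \<circ>\<^sub>p g = (f \<circ>\<^sub>p g) ^ n"
  by (induction n) (simp_all add: pcompose_mult pcompose_1)

lemma pcompose_monom: "monom c n \<circ>\<^sub>p g = Polynomial.smult c (g ^ n)"
  by (simp add: monom_altdef pcompose_smult pcompose_power pcompose_pCons)

lemma pcompose_linear_power_shift:
  fixes c :: "'a::field"
  shows "([:- c, 1:] ^ n * h) \<circ>\<^sub>p [:c, 1:] = monom 1 n * (h \<circ>\<^sub>p [:c, 1:])"
  by (simp add: pcompose_mult pcompose_power pcompose_pCons monom_altdef)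

lemma sum_fun_apply: "(\<Sum>i\<in>I. f i) k = (\<Sum>i\<in>I. f i k :: 'a::comm_monoid_add)"
  by (induction I rule: infinite_finite_induct) simp_all

text \<open>Up to a factor, the pairing with \<open>binom_seq i * geo_seq c\<close> is the \<open>i\<close>th Taylor coefficient at \<open>c\<close>.\<close>

lemma pairing_binom_geo:
  "pairing f (\<lambda>k. of_nat (k choose i) * c ^ k) = c ^ i * coeff (f \<circ>\<^sub>p [:c, 1:]) i"
proof -
  have "f \<circ>\<^sub>p [:c, 1:] = (\<Sum>k\<le>degree f. Polynomial.smult (coeff f k) ([:c, 1:] ^ k))"
    by (subst (1) poly_as_sum_of_monoms[of f, symmetric]) (simp add: pcompose_sum pcompose_monom)
  then have "c ^ i * coeff (f \<circ>\<^sub>p [:c, 1:]) i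
      = (\<Sum>k\<le>degree f. coeff f k * (coeff ([:c, 1:] ^ k) i * c ^ i))"
    by (simp add: coeff_sum sum_distrib_left mult_ac)
  then show ?thesis by (simp only: coeff_linear_power_shift pairing_def)
qed

lemma coeff_dvd_shifted_power:
  fixes f :: "'a::field poly"
  assumes "[:- c, 1:] ^ n dvd f" "i < n"
  shows "coeff (f \<circ>\<^sub>p [:c, 1:]) i = 0"
proof -
  from assms(1) obtain g where "f = [:- c, 1:] ^ n * g" by blast
  then have "f \<circ>\<^sub>p [:c, 1:] = monom 1 n * (g \<circ>\<^sub>p [:c, 1:])"
    by (simp add: pcompose_linear_power_shift)
  then show ?thesis using assms(2) by (simp add: coeff_monom_mult)
qed

text \<open>
  If \<open>n\<close> is the largest index with \<open>a n c \<noteq> 0\<close>, the combination is paired with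
  \<open>f = X ^ K * (X - c) ^ n * (\<Prod>d \<noteq> c. (X - d) ^ (l + 1))\<close>. The factor \<open>X ^ K\<close> discards the first \<open>K\<close>
  terms, and of all Taylor coefficients at \<open>L\<close> that meet a nonzero \<open>a i d\<close> only the \<open>n\<close>th one at \<open>c\<close> is
  nonzero.
\<close>

lemma binom_geo_independent:
  fixes L :: "'a::field set" and a :: "nat \<Rightarrow> 'a \<Rightarrow> 'a"
  assumes L: "finite L" "0 \<notin> L"
    and zero: "\<And>k. K \<le> k \<Longrightarrow> (\<Sum>i\<le>l. \<Sum>c\<in>L. a i c * (of_nat (k choose i) * c ^ k)) = 0"
    and i: "i \<le> l" "c \<in> L"
  shows "a i c = 0"
proof (rule ccontr)
  assume "a i c \<noteq> 0"
  define I where "I = {i. i \<le> l \<and> a i c \<noteq> 0}"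
  have "finite I" "i \<in> I" using \<open>a i c \<noteq> 0\<close> i by (auto simp: I_def)
  define n where "n = Max I"
  have "n \<in> I" unfolding n_def using \<open>finite I\<close> \<open>i \<in> I\<close> by (intro Max_in) auto
  then have n: "n \<le> l" "a n c \<noteq> 0" by (simp_all add: I_def)
  have gt_n: "a j c = 0" if "n < j" "j \<le> l" for j
  proof (rule ccontr)
    assume "a j c \<noteq> 0"
    then have "j \<in> I" using that by (simp add: I_def)
    then show False using Max_ge[OF \<open>finite I\<close>] that by (fastforce simp: n_def)
  qed
  define h where "h = monom 1 K * (\<Prod>d\<in>L - {c}. [:- d, 1:] ^ Suc l)"
  define f where "f = [:- c, 1:] ^ n * h"
  let ?s = "\<lambda>i c k. of_nat (k choose i) * c ^ k :: 'a"
  have "pairing f (\<lambda>k. \<Sum>i\<le>l. \<Sum>c\<in>L. a i c * ?s i c k) = 0"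
    unfolding pairing_def
  proof (intro sum.neutral ballI)
    fix k
    have f: "f = monom 1 K * ([:- c, 1:] ^ n * (\<Prod>d\<in>L - {c}. [:- d, 1:] ^ Suc l))"
      by (simp add: f_def h_def mult_ac)
    show "coeff f k * (\<Sum>i\<le>l. \<Sum>c\<in>L. a i c * ?s i c k) = 0"
    proof (cases "K \<le> k")
      case True
      then show ?thesis using zero by simp
    next
      case False
      then show ?thesis by (simp add: f coeff_monom_mult)
    qed
  qed
  also have "pairing f (\<lambda>k. \<Sum>i\<le>l. \<Sum>c\<in>L. a i c * ?s i c k)
      = (\<Sum>k\<le>degree f. \<Sum>i\<le>l. \<Sum>c\<in>L. a i c * (coeff f k * ?s i c k))"
    unfolding pairing_def sum_distrib_left by (intro sum.cong refl) (simp only: mult_ac)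
  also have "\<dots> = (\<Sum>i\<le>l. \<Sum>k\<le>degree f. \<Sum>c\<in>L. a i c * (coeff f k * ?s i c k))"
    by (rule sum.swap)
  also have "\<dots> = (\<Sum>i\<le>l. \<Sum>c\<in>L. \<Sum>k\<le>degree f. a i c * (coeff f k * ?s i c k))"
    by (intro sum.cong refl sum.swap)
  also have "\<dots> = (\<Sum>i\<le>l. \<Sum>d\<in>L. a i d * (d ^ i * coeff (f \<circ>\<^sub>p [:d, 1:]) i))"
    unfolding pairing_binom_geo[symmetric] pairing_def sum_distrib_left ..
  also have "\<dots> = (\<Sum>i\<le>l. \<Sum>d\<in>L. if d = c \<and> i = n then a n c * (c ^ n * poly h c) else 0)"
  proof (intro sum.cong refl)
    fix j d assume j: "j \<in> {..l}" and d: "d \<in> L"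
    show "a j d * (d ^ j * coeff (f \<circ>\<^sub>p [:d, 1:]) j) = (if d = c \<and> j = n then a n c * (c ^ n * poly h c) else 0)"
    proof (cases "d = c")
      case False
      have "[:- d, 1:] ^ Suc l dvd (\<Prod>d\<in>L - {c}. [:- d, 1:] ^ Suc l)"
        using L d False by (intro dvd_prodI) auto
      then have "[:- d, 1:] ^ Suc l dvd f" unfolding f_def h_def by (intro dvd_mult)
      then show ?thesis using coeff_dvd_shifted_power[of d "Suc l" f j] j False by simp
    next
      case True
      consider "j < n" | "j = n" | "n < j" by linarith
      then show ?thesis
      proof cases
        case 1
        then show ?thesis using coeff_dvd_shifted_power[of c n f j] True by (simp add: f_def)
      next
        case 2
        have "f \<circ>\<^sub>p [:c, 1:] = monom 1 n * (h \<circ>\<^sub>p [:c, 1:])"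
          by (simp add: f_def pcompose_linear_power_shift)
        then have "coeff (f \<circ>\<^sub>p [:c, 1:]) n = poly h c"
          by (simp add: coeff_monom_mult flip: poly_0_coeff_0) (simp add: poly_pcompose)
        then show ?thesis using 2 True by simp
      next
        case 3
        then show ?thesis using gt_n j True by simp
      qed
    qed
  qed
  also have "\<dots> = a n c * (c ^ n * poly h c)"
  proof -
    have "(\<Sum>d\<in>L. if d = c \<and> i = n then x else 0) = (if i = n then x else 0)" for i and x :: 'a
      using L i by (simp add: sum.delta if_distrib conj_commute cong: if_cong)
    then show ?thesis using n by simp
  qed
  finally have "poly h c = 0" using n L i by auto
  moreover have "poly h c \<noteq> 0"
    using L i by (auto simp: h_def poly_monom poly_prod poly_power)
  ultimately show False by simp
qed

lemma span_geo_representation: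
  assumes "s \<in> span_geo"
  obtains L a where "finite L" "0 \<notin> L" "\<And>k. s k = (\<Sum>c\<in>L. a c * c ^ k)"
proof -
  from assms obtain T r where T: "finite T" "T \<subseteq> {geo_seq c |c. c \<noteq> 0}"
    and s: "s = (\<Sum>v\<in>T. seq_scale (r v) v)"
    unfolding span_geo_def seq.span_explicit by blast
  have inj: "inj (geo_seq :: 'a \<Rightarrow> nat \<Rightarrow> 'a)"
    by (rule injI) (drule fun_cong[of _ _ 1], simp add: geo_seq_def)
  define L where "L = {c. c \<noteq> 0 \<and> geo_seq c \<in> T}"
  have TL: "T = geo_seq ` L" using T(2) by (auto simp: L_def)
  have "finite L" using T(1) inj unfolding TL by (meson finite_imageD inj_on_subset subset_UNIV)
  moreover have "s k = (\<Sum>c\<in>L. r (geo_seq c) * c ^ k)" for k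
  proof -
    have "s = (\<Sum>c\<in>L. seq_scale (r (geo_seq c)) (geo_seq c))"
      unfolding s TL using inj by (subst sum.reindex) (auto intro: inj_on_subset)
    then show ?thesis by (simp add: sum_fun_apply seq_scale_def geo_seq_def)
  qed
  ultimately show ?thesis using that[of L "\<lambda>c. r (geo_seq c)"] by (simp add: L_def)
qed

lemma span_delta_eventually_0:
  assumes "s \<in> span_delta"
  obtains K where "\<And>k. K \<le> k \<Longrightarrow> s k = 0"
proof -
  have "\<exists>K. \<forall>k\<ge>K. s k = 0"
    using assms unfolding span_delta_def
  proof (induction rule: seq.span_induct_alt)
    case base
    then show ?case by simp
  next
    case (step c x y)
    then obtain i K where "x = delta_seq i" "\<forall>k\<ge>K. y k = 0" by auto
    then have "\<forall>k\<ge>max K (Suc i). (seq_scale c x + y) k = 0"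
      by (auto simp: seq_scale_def delta_seq_def)
    then show ?case by blast
  qed
  then show ?thesis using that by blast
qed

lemma canonical_sequence_unique:
  fixes n :: "nat \<Rightarrow> 'a::field"
  assumes n: "n \<in> span_delta" and b: "\<And>i. i \<le> l \<Longrightarrow> b i \<in> span_geo"
    and zero: "n + (\<Sum>i\<le>l. binom_seq i * b i) = 0"
  shows "n = 0" "\<And>i. i \<le> l \<Longrightarrow> b i = 0"
proof -
  have "\<forall>i\<in>{..l}. \<exists>L a. finite L \<and> 0 \<notin> L \<and> (\<forall>k. b i k = (\<Sum>c\<in>L. a c * c ^ k))"
    using span_geo_representation[OF b] by (metis atMost_iff)
  then obtain L a where La: "\<And>i. i \<le> l \<Longrightarrow> finite (L i) \<and> 0 \<notin> L i \<and> (\<forall>k. b i k = (\<Sum>c\<in>L i. a i c * c ^ k))"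
    by (metis atMost_iff)
  define LL where "LL = (\<Union>i\<le>l. L i)"
  define a' where "a' i c = (if c \<in> L i then a i c else 0)" for i c
  have LL: "finite LL" "0 \<notin> LL" using La by (auto simp: LL_def)
  have b_eq: "b i k = (\<Sum>c\<in>LL. a' i c * c ^ k)" if "i \<le> l" for i k
  proof -
    have "(\<Sum>c\<in>L i. a i c * c ^ k) = (\<Sum>c\<in>LL. a' i c * c ^ k)"
      using that LL by (intro sum.mono_neutral_cong_left) (auto simp: LL_def a'_def)
    then show ?thesis using La[OF that] by simp
  qed
  obtain K where K: "\<And>k. K \<le> k \<Longrightarrow> n k = 0" using span_delta_eventually_0[OF n] by blast
  have a0: "a' i c = 0" if "i \<le> l" "c \<in> LL" for i c
  proof (rule binom_geo_independent[OF LL _ that])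
    fix k assume "K \<le> k"
    have "(n + (\<Sum>i\<le>l. binom_seq i * b i)) k = 0" using zero by simp
    then have "(\<Sum>i\<le>l. binom_seq i k * b i k) = 0"
      using K[OF \<open>K \<le> k\<close>] by (simp add: sum_fun_apply)
    then show "(\<Sum>i\<le>l. \<Sum>c\<in>LL. a' i c * (of_nat (k choose i) * c ^ k)) = 0"
      by (simp add: binom_seq_def b_eq sum_distrib_left mult_ac)
  qed
  show b0: "b i = 0" if "i \<le> l" for i
    using b_eq[OF that] a0[OF that] by (auto simp: fun_eq_iff)
  show "n = 0" using zero b0 by simp
qed

section \<open>Matrices of sequences\<close>

text \<open>The \<open>k\<close>th term of a matrix of sequences, read as a sequence of matrices.\<close>

definition mat_at :: "nat \<Rightarrow> (nat \<Rightarrow> 'a) mat \<Rightarrow> 'a mat" where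
  "mat_at k Z = map_mat (\<lambda>s. s k) Z"

lemma mat_at_carrier [simp]: "mat_at k Z \<in> carrier_mat n m \<longleftrightarrow> Z \<in> carrier_mat n m"
  by (simp add: mat_at_def)

lemma dim_mat_at [simp]: "dim_row (mat_at k Z) = dim_row Z" "dim_col (mat_at k Z) = dim_col Z"
  by (simp_all add: mat_at_def)

lemma index_mat_at [simp]:
  "r < dim_row Z \<Longrightarrow> s < dim_col Z \<Longrightarrow> mat_at k Z $$ (r, s) = (Z $$ (r, s)) k"
  by (simp add: mat_at_def)

lemma mat_at_eqI:
  assumes "Z \<in> carrier_mat n m" "Z' \<in> carrier_mat n m" "\<And>k. mat_at k Z = mat_at k Z'"
  shows "Z = Z'"
proof (rule eq_matI)
  fix r s assume rs: "r < dim_row Z'" "s < dim_col Z'"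
  show "Z $$ (r, s) = Z' $$ (r, s)"
  proof
    fix k
    have "mat_at k Z $$ (r, s) = mat_at k Z' $$ (r, s)" using assms(3) by simp
    then show "(Z $$ (r, s)) k = (Z' $$ (r, s)) k" using assms(1,2) rs by simp
  qed
qed (use assms(1,2) in auto)

lemma semiring_hom_term: "semiring_hom (\<lambda>s :: nat \<Rightarrow> 'a::comm_ring_1. s k)"
  by unfold_locales simp_all

lemma mat_at_mult:
  fixes Z Z' :: "(nat \<Rightarrow> 'a::comm_ring_1) mat"
  shows "Z \<in> carrier_mat n m \<Longrightarrow> Z' \<in> carrier_mat m l \<Longrightarrow> mat_at k (Z * Z') = mat_at k Z * mat_at k Z'"
  unfolding mat_at_def by (rule semiring_hom.mat_hom_mult[OF semiring_hom_term])

lemma mat_at_pow: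
  fixes Z :: "(nat \<Rightarrow> 'a::comm_ring_1) mat"
  shows "Z \<in> carrier_mat n n \<Longrightarrow> mat_at k (Z ^\<^sub>m i) = mat_at k Z ^\<^sub>m i"
  unfolding mat_at_def by (rule semiring_hom.mat_hom_pow[OF semiring_hom_term])

lemma mat_at_one: "mat_at k (1\<^sub>m n :: (nat \<Rightarrow> 'a::comm_ring_1) mat) = 1\<^sub>m n"
  unfolding mat_at_def by (rule semiring_hom.mat_hom_one[OF semiring_hom_term])

lemma mat_at_zero: "mat_at k (0\<^sub>m n m :: (nat \<Rightarrow> 'a::comm_ring_1) mat) = 0\<^sub>m n m"
  by (rule eq_matI) auto

lemma mat_at_add:
  fixes Z Z' :: "(nat \<Rightarrow> 'a::comm_ring_1) mat"
  shows "Z \<in> carrier_mat n m \<Longrightarrow> Z' \<in> carrier_mat n m \<Longrightarrow> mat_at k (Z + Z') = mat_at k Z + mat_at k Z'"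
  by (rule eq_matI) auto

lemma mat_at_smult:
  fixes Z :: "(nat \<Rightarrow> 'a::comm_ring_1) mat"
  shows "mat_at k (s \<cdot>\<^sub>m Z) = s k \<cdot>\<^sub>m mat_at k Z"
  by (rule eq_matI) auto

lemma mat_at_mat_sum:
  fixes f :: "'i \<Rightarrow> (nat \<Rightarrow> 'a::comm_ring_1) mat"
  assumes "\<And>i. i \<in> I \<Longrightarrow> f i \<in> carrier_mat q q"
  shows "mat_at k (mat_sum q f I) = mat_sum q (\<lambda>i. mat_at k (f i)) I"
proof (rule eq_matI)
  fix r s assume "r < dim_row (mat_sum q (\<lambda>i. mat_at k (f i)) I)" "s < dim_col (mat_sum q (\<lambda>i. mat_at k (f i)) I)"
  then have rs: "r < q" "s < q" by simp_all
  have "(\<Sum>i\<in>I. (f i $$ (r, s)) k) = (\<Sum>i\<in>I. mat_at k (f i) $$ (r, s))"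
    using assms rs by (intro sum.cong refl) (metis carrier_matD index_mat_at)
  then show "mat_at k (mat_sum q f I) $$ (r, s) = mat_sum q (\<lambda>i. mat_at k (f i)) I $$ (r, s)"
    using rs by (simp add: sum_fun_apply)
qed simp_all

lemma dim_seq_times_mat [simp]:
  "dim_row (seq_times_mat s B) = dim_row B" "dim_col (seq_times_mat s B) = dim_col B"
  by (simp_all add: seq_times_mat_def)

lemma seq_times_mat_carrier [simp]: "seq_times_mat s B \<in> carrier_mat n m \<longleftrightarrow> B \<in> carrier_mat n m"
  by (simp only: carrier_mat_def mem_Collect_eq dim_seq_times_mat)

lemma mat_at_seq_times_mat: "mat_at k (seq_times_mat s B) = s k \<cdot>\<^sub>m B"
  by (rule eq_matI) (auto simp: seq_times_mat_def)

lemma mat_at_power_seq: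
  assumes "A \<in> carrier_mat q q"
  shows "mat_at k (power_seq A) = A ^\<^sub>m k"
proof -
  have "dim_row (A ^\<^sub>m k) = q" "dim_col (A ^\<^sub>m k) = q"
    using pow_carrier_mat[OF assms, of k] by auto
  then show ?thesis
    using assms by (intro eq_matI) (simp_all add: power_seq_def mat_of_seq_def)
qed

lemma power_seq_carrier: "A \<in> carrier_mat q q \<Longrightarrow> power_seq A \<in> carrier_mat q q"
  by (auto simp: power_seq_def mat_of_seq_def)

text \<open>The exponent has to be the same for all terms.\<close>

lemma nilpotent_matI_terms:
  fixes Z :: "(nat \<Rightarrow> 'a::comm_ring_1) mat"
  assumes Z: "Z \<in> carrier_mat q q" and "\<And>k. mat_at k Z ^\<^sub>m n = 0\<^sub>m q q"
  shows "nilpotent_mat Z"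
proof -
  have "Z ^\<^sub>m n = 0\<^sub>m q q"
    using assms by (intro mat_at_eqI[of _ q q]) (auto simp: mat_at_pow[OF Z] mat_at_zero intro: pow_carrier_mat)
  then show ?thesis using Z unfolding nilpotent_mat_def by auto
qed

lemma mat_sum_delta:
  assumes "finite I" "\<And>i. i \<in> I \<Longrightarrow> B i \<in> carrier_mat q q"
  shows "mat_sum q (\<lambda>i. delta_seq i k \<cdot>\<^sub>m B i) I = (if k \<in> I then B k else 0\<^sub>m q q)"
proof (rule eq_matI)
  fix r s assume "r < dim_row (if k \<in> I then B k else 0\<^sub>m q q)" "s < dim_col (if k \<in> I then B k else 0\<^sub>m q q)"
  then have rs: "r < q" "s < q" using assms(2)[of k] by (auto split: if_splits)
  have "(\<Sum>i\<in>I. (delta_seq i k \<cdot>\<^sub>m B i) $$ (r, s)) = (\<Sum>i\<in>I. if i = k then B k $$ (r, s) else 0)"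
  proof (intro sum.cong refl)
    fix i assume "i \<in> I"
    from assms(2)[OF this] show "(delta_seq i k \<cdot>\<^sub>m B i) $$ (r, s) = (if i = k then B k $$ (r, s) else 0)"
      using rs by (auto simp: delta_seq_def)
  qed
  then show "mat_sum q (\<lambda>i. delta_seq i k \<cdot>\<^sub>m B i) I $$ (r, s) = (if k \<in> I then B k else 0\<^sub>m q q) $$ (r, s)"
    using rs assms(1) by (simp add: sum.delta')
qed (use assms(2)[of k] in auto)

lemma elements_mat_sum_seq_times_mat:
  assumes B: "\<And>i. i \<in> I \<Longrightarrow> B i \<in> carrier_mat q q" and S: "\<And>i. i \<in> I \<Longrightarrow> s i \<in> S"
  shows "elements_mat (mat_sum q (\<lambda>i. seq_times_mat (s i) (B i)) I) \<subseteq> seq.span S"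
proof
  fix x assume "x \<in> elements_mat (mat_sum q (\<lambda>i. seq_times_mat (s i) (B i)) I)"
  from elements_matD[OF this] obtain r c where rc: "r < q" "c < q"
    and x: "x = mat_sum q (\<lambda>i. seq_times_mat (s i) (B i)) I $$ (r, c)"
    unfolding dim_mat_sum by blast
  have "x = (\<Sum>i\<in>I. seq_scale (B i $$ (r, c)) (s i))"
    unfolding x index_mat_sum[OF rc]
  proof (intro sum.cong refl)
    fix i assume "i \<in> I"
    from B[OF this] show "seq_times_mat (s i) (B i) $$ (r, c) = seq_scale (B i $$ (r, c)) (s i)"
      using rc by (auto simp: seq_times_mat_def seq_scale_def fun_eq_iff mult.commute)
  qed
  then show "x \<in> seq.span S"
    by (simp only:) (intro seq.span_sum seq.span_scale seq.span_base S)
qed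

section \<open>Uniqueness of the canonical form\<close>

lemma elements_mat_index: "Z \<in> carrier_mat n m \<Longrightarrow> r < n \<Longrightarrow> s < m \<Longrightarrow> Z $$ (r, s) \<in> elements_mat Z"
  by (rule elements_matI) simp_all

lemma is_canonical_form_unique:
  assumes "is_canonical_form A (N, C)" "is_canonical_form A (N', C')"
  shows "N = N' \<and> C = C'"
proof -
  define q where "q = dim_row A"
  obtain l where N: "N \<in> carrier_mat q q" "elements_mat N \<subseteq> span_delta"
    and C: "\<And>i. C i \<in> carrier_mat q q" "\<And>i. elements_mat (C i) \<subseteq> span_geo"
    and l: "\<And>i. l < i \<Longrightarrow> C i = 0\<^sub>m q q"
      "power_seq A = N + mat_sum q (\<lambda>i. binom_seq i \<cdot>\<^sub>m C i) {..l}"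
    using assms(1) by (auto simp: is_canonical_form_def q_def Let_def)
  obtain l' where N': "N' \<in> carrier_mat q q" "elements_mat N' \<subseteq> span_delta"
    and C': "\<And>i. C' i \<in> carrier_mat q q" "\<And>i. elements_mat (C' i) \<subseteq> span_geo"
    and l': "\<And>i. l' < i \<Longrightarrow> C' i = 0\<^sub>m q q"
      "power_seq A = N' + mat_sum q (\<lambda>i. binom_seq i \<cdot>\<^sub>m C' i) {..l'}"
    using assms(2) by (auto simp: is_canonical_form_def q_def Let_def)
  define L where "L = max l l'"
  have eq: "N $$ (r, s) = N' $$ (r, s) \<and> (\<forall>i\<le>L. C i $$ (r, s) = C' i $$ (r, s))"
    if rs: "r < q" "s < q" for r s
  proof -
    have extend: "(\<Sum>i\<le>k. binom_seq i * D i $$ (r, s)) = (\<Sum>i\<le>L. binom_seq i * D i $$ (r, s))"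
      if "k \<le> L" "\<And>i. k < i \<Longrightarrow> D i = 0\<^sub>m q q" for k and D :: "nat \<Rightarrow> (nat \<Rightarrow> 'a) mat"
      using that rs by (intro sum.mono_neutral_left) auto
    have "power_seq A $$ (r, s) = N $$ (r, s) + (\<Sum>i\<le>l. binom_seq i * C i $$ (r, s))"
      unfolding l(2) using rs N C(1)[THEN carrier_matD(1)] C(1)[THEN carrier_matD(2)] by simp
    moreover have "power_seq A $$ (r, s) = N' $$ (r, s) + (\<Sum>i\<le>l'. binom_seq i * C' i $$ (r, s))"
      unfolding l'(2) using rs N' C'(1)[THEN carrier_matD(1)] C'(1)[THEN carrier_matD(2)] by simp
    ultimately have "N $$ (r, s) + (\<Sum>i\<le>L. binom_seq i * C i $$ (r, s))
        = N' $$ (r, s) + (\<Sum>i\<le>L. binom_seq i * C' i $$ (r, s))"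
      using extend[of l C] extend[of l' C'] l(1) l'(1) by (simp add: L_def)
    then have zero: "(N $$ (r, s) - N' $$ (r, s))
        + (\<Sum>i\<le>L. binom_seq i * (C i $$ (r, s) - C' i $$ (r, s))) = 0"
      by (simp add: algebra_simps sum_subtractf)
    have n: "N $$ (r, s) - N' $$ (r, s) \<in> span_delta"
      using elements_mat_index[OF N(1) rs] elements_mat_index[OF N'(1) rs] N(2) N'(2)
      unfolding span_delta_def by (intro seq.span_diff) auto
    have c: "C i $$ (r, s) - C' i $$ (r, s) \<in> span_geo" for i
      using elements_mat_index[OF C(1) rs] elements_mat_index[OF C'(1) rs] C(2) C'(2)
      unfolding span_geo_def by (intro seq.span_diff) blast+
    show ?thesis using canonical_sequence_unique[OF n c zero] by simp
  qed
  have "N = N'" using eq N N' by (intro eq_matI) auto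
  moreover have "C i = C' i" for i
  proof (cases "i \<le> L")
    case True
    show ?thesis
    proof (rule eq_matI)
      fix r s assume "r < dim_row (C' i)" "s < dim_col (C' i)"
      then show "C i $$ (r, s) = C' i $$ (r, s)" using eq True C'(1)[of i] by simp
    qed (use C(1)[of i] C'(1)[of i] in auto)
  next
    case False
    then show ?thesis using l(1)[of i] l'(1)[of i] by (simp add: L_def)
  qed
  ultimately show ?thesis by blast
qed

lemma canonical_form_eq:
  assumes "is_canonical_form A (N, C)"
  shows "nongeometric_part A = N" "coordinate A i = C i"
proof -
  have "canonical_form A = (N, C)"
    unfolding canonical_form_def
  proof (rule the_equality)
    fix NC assume NC: "is_canonical_form A NC"
    obtain N' C' where eq: "NC = (N', C')" by (cases NC)
    from is_canonical_form_unique[OF NC[unfolded eq] assms] show "NC = (N, C)" by (simp add: eq)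
  qed (rule assms)
  then show "nongeometric_part A = N" "coordinate A i = C i"
    by (simp_all add: nongeometric_part_def coordinate_def)
qed

section \<open>The canonical form of a matrix with split minimal polynomial\<close>

lemma smult_poly_sum: "Polynomial.smult c (\<Sum>i\<in>I. f i) = (\<Sum>i\<in>I. Polynomial.smult c (f i))"
  by (induction I rule: infinite_finite_induct) (simp_all add: smult_add_right)

text \<open>
  Modulo \<open>(X - c) ^ n\<close>, the Taylor expansion of \<open>X ^ k\<close> at \<open>c\<close> can be cut off after degree \<open>n - 1\<close>, or
  after any larger degree \<open>l\<close>. Dividing by \<open>c ^ i\<close> instead of writing \<open>c ^ (k - i)\<close> keeps the terms
  geometric in \<open>k\<close>; for \<open>i > k\<close> the binomial coefficient is \<open>0\<close>.
\<close>

lemma linear_power_dvd_taylor_remainder: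
  fixes c :: "'a::field"
  assumes c: "c \<noteq> 0" and n: "n \<le> Suc l"
  shows "[:- c, 1:] ^ n dvd monom 1 k
    - (\<Sum>i\<le>l. Polynomial.smult (of_nat (k choose i) * (c ^ k * inverse c ^ i)) ([:- c, 1:] ^ i))"
proof -
  define T where "T i = Polynomial.smult (of_nat (k choose i) * (c ^ k * inverse c ^ i)) ([:- c, 1:] ^ i)" for i
  have T: "of_nat (k choose i) * [:- c, 1:] ^ i * [:c:] ^ (k - i) = T i" if "i \<le> k" for i
  proof -
    have "c ^ (k - i) = c ^ k * inverse c ^ i"
      using that c by (simp add: power_diff field_simps)
    then show ?thesis by (simp add: T_def of_nat_poly poly_const_pow mult.commute)
  qed
  have "monom 1 k = ([:- c, 1:] + [:c:]) ^ k" by (simp add: monom_altdef)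
  also have "\<dots> = (\<Sum>i\<le>k. T i)"
    unfolding binomial_ring by (rule sum.cong) (simp_all only: T atMost_iff)
  also have "\<dots> = (\<Sum>i\<le>max k l. T i)"
    by (intro sum.mono_neutral_left) (auto simp: T_def binomial_eq_0 not_le)
  also have "\<dots> = (\<Sum>i\<le>l. T i) + (\<Sum>i\<in>{..max k l} - {..l}. T i)"
    by (subst sum.subset_diff[of "{..l}"]) auto
  finally have "monom 1 k - (\<Sum>i\<le>l. T i) = (\<Sum>i\<in>{..max k l} - {..l}. T i)" by simp
  moreover have "[:- c, 1:] ^ n dvd (\<Sum>i\<in>{..max k l} - {..l}. T i)"
    unfolding T_def using n by (intro dvd_sum dvd_smult le_imp_power_dvd) auto
  ultimately show ?thesis by (simp add: T_def)
qed

text \<open>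
  The index \<open>z\<close> stands for the eigenvalue \<open>0\<close>, which may have exponent \<open>0\<close>. All other \<open>ev j\<close>
  are eigenvalues.
\<close>

locale split_minimal_poly_at_0 = split_minimal_poly +
  fixes z
  assumes z: "z \<in> J" "ev z = 0"
    and t_pos: "\<And>j. j \<in> J - {z} \<Longrightarrow> t j \<ge> 1"
begin

lemma ev_nonzero: "j \<in> J - {z} \<Longrightarrow> ev j \<noteq> 0"
  using inj_onD[OF inj_ev, of j z] z by auto

text \<open>The matrices of sequences that turn out to be the coordinates of \<open>A\<close>.\<close>

definition coord :: "nat \<Rightarrow> (nat \<Rightarrow> 'a) mat" where
  "coord i = mat_sum q (\<lambda>j. seq_times_mat (geo_seq (ev j))
     (inverse (ev j) ^ i \<cdot>\<^sub>m M ([:- ev j, 1:] ^ i * idem j))) (J - {z})"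

text \<open>The matrix of sequences that turns out to be the non-geometric part of \<open>A\<close>.\<close>

definition nongeo :: "(nat \<Rightarrow> 'a) mat" where
  "nongeo = mat_sum q (\<lambda>i. seq_times_mat (delta_seq i) (M (monom 1 i * idem z))) {..<t z}"

text \<open>The polynomial in \<open>A\<close> that is the \<open>k\<close>th term of \<open>coord i\<close>.\<close>

definition coord_poly :: "nat \<Rightarrow> nat \<Rightarrow> 'a poly" where
  "coord_poly i k = (\<Sum>j\<in>J - {z}.
     Polynomial.smult (ev j ^ k * inverse (ev j) ^ i) ([:- ev j, 1:] ^ i * idem j))"

lemma coord_carrier [simp]: "coord i \<in> carrier_mat q q"
  by (simp add: coord_def)

lemma nongeo_carrier [simp]: "nongeo \<in> carrier_mat q q"
  by (simp add: nongeo_def)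

lemma mat_at_coord: "mat_at k (coord i) = M (coord_poly i k)"
proof -
  have "mat_at k (coord i) = mat_sum q (\<lambda>j. mat_at k (seq_times_mat (geo_seq (ev j))
     (inverse (ev j) ^ i \<cdot>\<^sub>m M ([:- ev j, 1:] ^ i * idem j)))) (J - {z})"
    unfolding coord_def by (rule mat_at_mat_sum) simp
  also have "\<dots> = M (coord_poly i k)"
    unfolding coord_poly_def poly_mat_sum[OF A]
    by (rule mat_sum_cong)
      (simp add: mat_at_seq_times_mat geo_seq_def poly_mat_smult[OF A] smult_smult_mat)
  finally show ?thesis .
qed

lemma M_monom_mult_idem_z: "t z \<le> k \<Longrightarrow> M (monom 1 k * idem z) = 0\<^sub>m q q"
  using z by (simp add: M_idem_mult_eq_0_iff monom_altdef le_imp_power_dvd)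

lemma mat_at_delta_sum:
  assumes "finite I"
  shows "mat_at k (mat_sum q (\<lambda>i. seq_times_mat (delta_seq i) (M (f i))) I)
    = (if k \<in> I then M (f k) else 0\<^sub>m q q)"
  using assms by (simp add: mat_at_mat_sum mat_at_seq_times_mat mat_sum_delta)

lemma mat_at_nongeo: "mat_at k nongeo = M (monom 1 k * idem z)"
  using M_monom_mult_idem_z by (simp add: nongeo_def mat_at_delta_sum)

lemma power_A: "A ^\<^sub>m k = M (monom 1 k)"
  by (simp add: monom_altdef poly_mat_power[OF A] poly_mat_X[OF A])

lemma mat_at_sum_coord:
  "mat_at k (mat_sum q (\<lambda>i. binom_seq i \<cdot>\<^sub>m coord i) I)
    = M (\<Sum>i\<in>I. Polynomial.smult (of_nat (k choose i)) (coord_poly i k))"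
  by (simp add: mat_at_mat_sum mat_at_smult mat_at_coord poly_mat_sum[OF A] poly_mat_smult[OF A] binom_seq_def)

text \<open>
  The polynomials of the \<open>k\<close>th terms of the two sides differ by
  \<open>X ^ k (1 - \<Sum> idem j) + \<Sum> (X ^ k - T j) idem j\<close>, where \<open>T j\<close> is the truncated Taylor expansion of \<open>X ^ k\<close>
  at \<open>ev j\<close> and the second sum omits \<open>z\<close>.
\<close>

theorem power_seq_eq:
  assumes l: "\<And>j. j \<in> J \<Longrightarrow> t j \<le> Suc l"
  shows "power_seq A = nongeo + mat_sum q (\<lambda>i. binom_seq i \<cdot>\<^sub>m coord i) {..l}"
proof (rule mat_at_eqI[of _ q q])
  fix k
  let ?S = "\<Sum>i\<le>l. Polynomial.smult (of_nat (k choose i)) (coord_poly i k)"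
  let ?T = "\<lambda>j. \<Sum>i\<le>l. Polynomial.smult (of_nat (k choose i) * (ev j ^ k * inverse (ev j) ^ i)) ([:- ev j, 1:] ^ i)"
  have S: "?S = (\<Sum>j\<in>J - {z}. ?T j * idem j)"
    unfolding coord_poly_def smult_poly_sum sum_distrib_right by (subst sum.swap) simp
  have "M (monom 1 k) = M (monom 1 k * idem z + ?S)"
    unfolding M_eq_iff
  proof
    fix i assume i: "i \<in> J"
    have sum_J: "(\<Sum>j\<in>J. h j) = h z + (\<Sum>j\<in>J - {z}. h j)" for h :: "_ \<Rightarrow> 'a poly"
      using z finite_J by (simp add: sum.remove)
    have "monom 1 k - (monom 1 k * idem z + ?S)
        = monom 1 k * (1 - (\<Sum>j\<in>J. idem j)) + (\<Sum>j\<in>J - {z}. (monom 1 k - ?T j) * idem j)"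
      unfolding S sum_J by (simp add: algebra_simps sum_subtractf sum_distrib_left)
    moreover have "[:- ev i, 1:] ^ t i dvd (monom 1 k - ?T j) * idem j" if j: "j \<in> J - {z}" for j
    proof (cases "i = j")
      case True
      then show ?thesis
        using linear_power_dvd_taylor_remainder[OF ev_nonzero[OF j] l[OF i], of k]
        by (intro dvd_mult2) (simp add: True)
    next
      case False
      show ?thesis by (rule dvd_mult[OF idem_cong_0[OF i False]])
    qed
    ultimately show "[:- ev i, 1:] ^ t i dvd monom 1 k - (monom 1 k * idem z + ?S)"
      by (simp only:) (intro dvd_add dvd_mult[OF idem_sum_cong_1[OF i]] dvd_sum)
  qed
  then show "mat_at k (power_seq A) = mat_at k (nongeo + mat_sum q (\<lambda>i. binom_seq i \<cdot>\<^sub>m coord i) {..l})"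
    by (simp add: mat_at_power_seq[OF A] power_A mat_at_add[of _ q q] mat_at_nongeo mat_at_sum_coord
        poly_mat_add[OF A])
qed (simp_all add: power_seq_carrier[OF A])

text \<open>The \<open>0\<close>th term already detects which coordinates vanish.\<close>

lemma coord_eq_0_iff: "coord i = 0\<^sub>m q q \<longleftrightarrow> (\<forall>j\<in>J - {z}. t j \<le> i)"
proof
  assume "coord i = 0\<^sub>m q q"
  then have "mat_at 0 (coord i) = 0\<^sub>m q q" by (simp add: mat_at_zero)
  then have 0: "[:- ev j, 1:] ^ t j dvd coord_poly i 0" if "j \<in> J" for j
    using that by (simp add: mat_at_coord M_eq_0_iff)
  show "\<forall>j\<in>J - {z}. t j \<le> i"
  proof
    fix j assume j: "j \<in> J - {z}"
    let ?h = "\<lambda>j. Polynomial.smult (ev j ^ 0 * inverse (ev j) ^ i) ([:- ev j, 1:] ^ i * idem j)"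
    have "coord_poly i 0 = ?h j + (\<Sum>j'\<in>J - {z} - {j}. ?h j')"
      unfolding coord_poly_def using finite_J j by (intro sum.remove) auto
    then have "?h j = coord_poly i 0 - (\<Sum>j'\<in>J - {z} - {j}. ?h j')" by simp
    also have "[:- ev j, 1:] ^ t j dvd \<dots>"
      using j 0 idem_cong_0 by (intro dvd_diff dvd_sum dvd_smult dvd_mult) auto
    finally have "[:- ev j, 1:] ^ t j dvd [:- ev j, 1:] ^ i * idem j"
      using ev_nonzero[OF j] by (simp add: dvd_smult_iff)
    then have "M ([:- ev j, 1:] ^ i * idem j) = 0\<^sub>m q q"
      unfolding M_eq_0_iff using idem_cong_0[of _ j] by (metis dvd_mult)
    then have "[:- ev j, 1:] ^ t j dvd [:- ev j, 1:] ^ i"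
      using j by (simp add: M_idem_mult_eq_0_iff)
    then show "t j \<le> i" by (simp add: dvd_power_iff is_unit_poly_iff)
  qed
next
  assume le: "\<forall>j\<in>J - {z}. t j \<le> i"
  show "coord i = 0\<^sub>m q q"
  proof (rule mat_at_eqI[of _ q q])
    fix k
    have "M ([:- ev j, 1:] ^ i * idem j) = 0\<^sub>m q q" if "j \<in> J - {z}" for j
      using le that by (simp add: M_idem_mult_eq_0_iff le_imp_power_dvd)
    then have "M (coord_poly i k) = mat_sum q (\<lambda>j. 0\<^sub>m q q) (J - {z})"
      unfolding coord_poly_def poly_mat_sum[OF A]
      by (intro mat_sum_cong) (simp add: poly_mat_smult[OF A])
    also have "\<dots> = 0\<^sub>m q q" by (rule eq_matI) simp_all
    finally show "mat_at k (coord i) = mat_at k (0\<^sub>m q q)" by (simp add: mat_at_coord mat_at_zero)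
  qed simp_all
qed

lemma is_canonical_form_coord: "is_canonical_form A (nongeo, coord)"
proof -
  define l where "l = (\<Sum>j\<in>J. t j)"
  have l: "t j \<le> l" if "j \<in> J" for j unfolding l_def using that finite_J by (simp add: member_le_sum)
  have "elements_mat nongeo \<subseteq> span_delta"
    unfolding nongeo_def span_delta_def by (rule elements_mat_sum_seq_times_mat) simp_all
  moreover have "elements_mat (coord i) \<subseteq> span_geo" for i
    unfolding coord_def span_geo_def
    by (rule elements_mat_sum_seq_times_mat) (use ev_nonzero in \<open>auto intro!: smult_carrier_mat\<close>)
  moreover have "coord i = 0\<^sub>m q q" if "l < i" for i
    unfolding coord_eq_0_iff using l that by fastforce
  moreover have "power_seq A = nongeo + mat_sum q (\<lambda>i. binom_seq i \<cdot>\<^sub>m coord i) {..l}"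
    using l by (intro power_seq_eq) (simp add: le_Suc_eq)
  ultimately show ?thesis by (auto simp: is_canonical_form_def)
qed

lemma nongeometric_part_eq: "nongeometric_part A = nongeo"
  and coordinate_eq: "coordinate A i = coord i"
  using canonical_form_eq[OF is_canonical_form_coord] by simp_all

section \<open>Nilpotency, and decomposition into nilpotent and diagonalizable parts\<close>

lemma nongeo_eq_0_iff: "nongeo = 0\<^sub>m q q \<longleftrightarrow> t z = 0"
proof
  assume "nongeo = 0\<^sub>m q q"
  then have "mat_at 0 nongeo = 0\<^sub>m q q" by (simp add: mat_at_zero)
  then have "M (1 * idem z) = 0\<^sub>m q q" by (simp add: mat_at_nongeo)
  then have "is_unit ([:- ev z, 1:] ^ t z)"
    using z M_idem_mult_eq_0_iff[of z 1] by simp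
  then show "t z = 0" by (simp only: is_unit_power_iff) (simp add: is_unit_poly_iff)
next
  assume "t z = 0"
  then show "nongeo = 0\<^sub>m q q" by (simp add: nongeo_def mat_sum_empty)
qed

lemma nilpotent_iff: "nilpotent_mat A \<longleftrightarrow> J = {z}"
proof
  assume "nilpotent_mat A"
  then obtain n where "A ^\<^sub>m n = 0\<^sub>m q q" by (auto simp: nilpotent_mat_def)
  then have dvd: "[:- ev j, 1:] ^ t j dvd monom 1 n" if "j \<in> J" for j
    using that by (simp add: power_A M_eq_0_iff)
  have False if j: "j \<in> J - {z}" for j
  proof -
    have "[:- ev j, 1:] dvd [:- ev j, 1:] ^ t j" using t_pos[OF j] by (simp add: dvd_power)
    then have "[:- ev j, 1:] dvd monom 1 n" using dvd[of j] j by (auto intro: dvd_trans)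
    then show False using ev_nonzero[OF j] by (simp add: dvd_iff_poly_eq_0 poly_monom)
  qed
  then show "J = {z}" using z by blast
next
  assume "J = {z}"
  then have "A ^\<^sub>m t z = 0\<^sub>m q q" using z by (simp add: power_A M_eq_0_iff monom_altdef)
  then show "nilpotent_mat A" unfolding nilpotent_mat_def using A by auto
qed

lemma coord_all_0_iff: "(\<forall>i. coord i = 0\<^sub>m q q) \<longleftrightarrow> J = {z}"
  unfolding coord_eq_0_iff using t_pos z(1) by force

lemma power_seq_eq_nongeo_iff: "power_seq A = nongeo \<longleftrightarrow> J = {z}"
proof
  assume "power_seq A = nongeo"
  then have "A ^\<^sub>m t z = mat_at (t z) nongeo" by (metis A mat_at_power_seq)
  then have "A ^\<^sub>m t z = 0\<^sub>m q q" by (simp add: mat_at_nongeo M_monom_mult_idem_z)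
  then have "nilpotent_mat A" unfolding nilpotent_mat_def using A by auto
  then show "J = {z}" by (simp add: nilpotent_iff)
next
  assume J: "J = {z}"
  show "power_seq A = nongeo"
  proof (rule mat_at_eqI[of _ q q])
    fix k
    have "M (monom 1 k * idem z) = M (monom 1 k)"
      using idem_cong_1[OF z(1)] J z(1) unfolding M_eq_iff
      by (metis dvd_mult dvd_minus_iff minus_diff_eq mult.right_neutral right_diff_distrib singletonD)
    then show "mat_at k (power_seq A) = mat_at k nongeo"
      by (simp add: mat_at_power_seq[OF A] power_A mat_at_nongeo)
  qed (simp_all add: power_seq_carrier[OF A])
qed

lemma nilpotent_coord:
  assumes "i \<ge> 1"
  shows "nilpotent_mat (coord i)"
proof (rule nilpotent_matI_terms)
  fix k
  have "poly (coord_poly i k) (ev j) = 0" if "j \<in> J" "t j \<noteq> 0" for j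
    unfolding coord_poly_def poly_sum
  proof (intro sum.neutral ballI)
    fix j' assume "j' \<in> J - {z}"
    then show "poly (Polynomial.smult (ev j' ^ k * inverse (ev j') ^ i) ([:- ev j', 1:] ^ i * idem j')) (ev j) = 0"
      using that assms by (cases "j = j'") (auto simp: poly_idem)
  qed
  then show "mat_at k (coord i) ^\<^sub>m (\<Sum>j\<in>J. t j) = 0\<^sub>m q q"
    unfolding mat_at_coord by (rule M_power_eq_0)
qed simp

text \<open>The non-geometric part without its \<open>0\<close>th term.\<close>

definition nongeo_nilpotent :: "(nat \<Rightarrow> 'a) mat" where
  "nongeo_nilpotent = mat_sum q (\<lambda>i. seq_times_mat (delta_seq i) (M (monom 1 i * idem z))) {1..<t z}"

lemma nongeo_nilpotent_carrier [simp]: "nongeo_nilpotent \<in> carrier_mat q q"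
  by (simp add: nongeo_nilpotent_def)

lemma mat_at_nongeo_nilpotent:
  "mat_at k nongeo_nilpotent = M (if k = 0 then 0 else monom 1 k * idem z)"
  using M_monom_mult_idem_z[of k] by (auto simp: nongeo_nilpotent_def mat_at_delta_sum poly_mat_0[OF A])

lemma mat_at_delta_0_idem: "mat_at k (seq_times_mat (delta_seq 0) (M (idem z))) = M (if k = 0 then idem z else 0)"
  by (auto simp: mat_at_seq_times_mat delta_seq_def poly_mat_0[OF A])

lemma nongeo_split: "nongeo = seq_times_mat (delta_seq 0) (M (idem z)) + nongeo_nilpotent"
  by (rule mat_at_eqI[of _ q q])
    (auto simp: mat_at_add[of _ q q] mat_at_nongeo mat_at_nongeo_nilpotent mat_at_delta_0_idem
      simp flip: poly_mat_add[OF A])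

lemma nilpotent_nongeo_nilpotent: "nilpotent_mat nongeo_nilpotent"
proof (rule nilpotent_matI_terms)
  fix k
  show "mat_at k nongeo_nilpotent ^\<^sub>m (\<Sum>j\<in>J. t j) = 0\<^sub>m q q"
    unfolding mat_at_nongeo_nilpotent
    by (rule M_power_eq_0) (use z in \<open>auto simp: poly_monom poly_idem\<close>)
qed simp

text \<open>
  The two parts of the decomposition. The index \<open>n\<close> bounds the coordinates that are summed; the sum is
  complete when \<open>t j \<le> n + 1\<close> for all nonzero eigenvalues.
\<close>

definition diagonalizable_part :: "(nat \<Rightarrow> 'a) mat" where
  "diagonalizable_part = seq_times_mat (delta_seq 0) (M (idem z)) + binom_seq 0 \<cdot>\<^sub>m coord 0"

definition nilpotent_part :: "nat \<Rightarrow> (nat \<Rightarrow> 'a) mat" where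
  "nilpotent_part n = nongeo_nilpotent + mat_sum q (\<lambda>i. binom_seq i \<cdot>\<^sub>m coord i) {1..n}"

lemma diagonalizable_part_carrier [simp]: "diagonalizable_part \<in> carrier_mat q q"
  by (simp add: diagonalizable_part_def)

lemma nilpotent_part_carrier [simp]: "nilpotent_part n \<in> carrier_mat q q"
  by (simp add: nilpotent_part_def)

lemma mat_at_diagonalizable_part: "mat_at k diagonalizable_part = M (semisimple (monom 1 k))"
proof -
  have "semisimple (monom 1 k) = (if k = 0 then idem z else 0) + coord_poly 0 k"
    unfolding semisimple_def coord_poly_def using z finite_J
    by (subst sum.remove[of _ z]) (auto simp: poly_monom)
  then show ?thesis
    by (simp add: diagonalizable_part_def mat_at_add[of _ q q] mat_at_delta_0_idem mat_at_smult mat_at_coord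
        binom_seq_def one_smult_mat poly_mat_add[OF A])
qed

lemma power_seq_decomposition:
  assumes n: "\<forall>j\<in>J - {z}. t j \<le> Suc n"
  shows "power_seq A = nilpotent_part n + diagonalizable_part"
proof -
  define l where "l = n + t z"
  let ?B = "\<lambda>i. binom_seq i \<cdot>\<^sub>m coord i"
  have "mat_sum q ?B {..l} = mat_sum q ?B {..n}"
  proof (rule eq_matI)
    fix r s assume "r < dim_row (mat_sum q ?B {..n})" "s < dim_col (mat_sum q ?B {..n})"
    then have rs: "r < q" "s < q" by simp_all
    have "coord i = 0\<^sub>m q q" if "n < i" for i
      unfolding coord_eq_0_iff using n that by (meson Suc_leI order_trans)
    then have "(\<Sum>i\<le>n. ?B i $$ (r, s)) = (\<Sum>i\<le>l. ?B i $$ (r, s))"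
      using rs by (intro sum.mono_neutral_left) (auto simp: l_def)
    then show "mat_sum q ?B {..l} $$ (r, s) = mat_sum q ?B {..n} $$ (r, s)" using rs by simp
  qed simp_all
  moreover have "{..n} = insert 0 {1..n}" by auto
  ultimately have sum: "mat_sum q ?B {..l} = ?B 0 + mat_sum q ?B {1..n}"
    by (simp add: mat_sum_insert)
  have "t j \<le> Suc l" if "j \<in> J" for j using n that by (cases "j = z") (force simp: l_def)+
  then have "power_seq A = nongeo + mat_sum q ?B {..l}" by (rule power_seq_eq)
  also have "\<dots> = nilpotent_part n + diagonalizable_part"
    unfolding nongeo_split sum nilpotent_part_def diagonalizable_part_def
    by (rule eq_matI) (auto simp: carrier_matD[OF coord_carrier] carrier_matD[OF nongeo_nilpotent_carrier])
  finally show ?thesis .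
qed

lemma mat_at_nilpotent_part:
  assumes n: "\<forall>j\<in>J - {z}. t j \<le> Suc n"
  shows "mat_at k (nilpotent_part n) = M (monom 1 k - semisimple (monom 1 k))"
proof -
  have "mat_at k (power_seq A) = mat_at k (nilpotent_part n) + M (semisimple (monom 1 k))"
    using power_seq_decomposition[OF n] by (simp add: mat_at_add[of _ q q] mat_at_diagonalizable_part)
  then have "M (monom 1 k) = mat_at k (nilpotent_part n) + M (semisimple (monom 1 k))"
    by (simp add: mat_at_power_seq[OF A] power_A)
  then have "M (monom 1 k - semisimple (monom 1 k))
      = mat_at k (nilpotent_part n) + M (semisimple (monom 1 k)) - M (semisimple (monom 1 k))"
    by (simp add: poly_mat_diff[OF A])
  also have "\<dots> = mat_at k (nilpotent_part n)"
    using nilpotent_part_carrier[of n] by (intro eq_matI) (auto simp del: nilpotent_part_carrier)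
  finally show ?thesis by simp
qed

lemma diagonalizable_diagonalizable_part: "diagonalizable_mat diagonalizable_part"
proof -
  \<comment> \<open>The diagonalizing matrix does not depend on the term, so it becomes a matrix of constant sequences.\<close>
  obtain P Q f where PQ: "P \<in> carrier_mat q q" "Q \<in> carrier_mat q q" "P * Q = 1\<^sub>m q" "Q * P = 1\<^sub>m q"
    and ss: "\<And>g. M (semisimple g) = P * mat q q (\<lambda>(r, s). if r = s then poly g (ev (f r)) else 0) * Q"
    by (rule semisimple_diagonalization) blast
  define const where "const B = map_mat (\<lambda>c (k::nat). c) B" for B :: "'a mat"
  have const: "const B \<in> carrier_mat q q" "mat_at k (const B) = B" if "B \<in> carrier_mat q q" for B k
    using that by (auto simp: const_def)
  define D where "D = mat q q (\<lambda>(r, s). if r = s then geo_seq (ev (f r)) else 0)"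
  have D: "D \<in> carrier_mat q q" "diagonal_mat D" by (auto simp: D_def diagonal_mat_def)
  have D_at: "mat_at k D = mat q q (\<lambda>(r, s). if r = s then poly (monom 1 k) (ev (f r)) else 0)" for k
    by (rule eq_matI) (auto simp: D_def geo_seq_def poly_monom)
  note c = const(1)[OF PQ(1)] const(1)[OF PQ(2)]
  have inv: "const P * const Q = 1\<^sub>m q" "const Q * const P = 1\<^sub>m q"
    using PQ const
    by (intro mat_at_eqI[OF mult_carrier_mat[OF c] one_carrier_mat]
          mat_at_eqI[OF mult_carrier_mat[OF c(2,1)] one_carrier_mat];
        simp add: mat_at_mult[OF c] mat_at_mult[OF c(2,1)] mat_at_one)+
  have "diagonalizable_part = const P * D * const Q"
  proof (rule mat_at_eqI[of _ q q])
    fix k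
    have "mat_at k (const P * D * const Q) = P * mat_at k D * Q"
      unfolding mat_at_mult[OF mult_carrier_mat[OF c(1) D(1)] c(2)] mat_at_mult[OF c(1) D(1)]
      using PQ const(2) by simp
    then show "mat_at k diagonalizable_part = mat_at k (const P * D * const Q)"
      by (simp add: mat_at_diagonalizable_part ss D_at)
  qed (use c D(1) in simp_all)
  then have "similar_mat diagonalizable_part D"
    using c D(1) inv by (intro similar_matI[of _ _ "const P" "const Q" q]) auto
  then show ?thesis unfolding diagonalizable_mat_def using D(2) by blast
qed

theorem is_nilpotent_diagonalizable_sum_power_seq:
  assumes n: "\<forall>j\<in>J - {z}. t j \<le> Suc n"
  shows "is_nilpotent_diagonalizable_sum q (power_seq A) (nilpotent_part n) diagonalizable_part"
proof -
  have "nilpotent_part n * diagonalizable_part = diagonalizable_part * nilpotent_part n"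
  proof (rule mat_at_eqI[of _ q q])
    fix k
    show "mat_at k (nilpotent_part n * diagonalizable_part) = mat_at k (diagonalizable_part * nilpotent_part n)"
      by (simp add: mat_at_mult[of _ q q _ q] mat_at_nilpotent_part[OF n] mat_at_diagonalizable_part
          mult.commute flip: poly_mat_mult[OF A])
  qed (auto intro: mult_carrier_mat[of _ q q])
  moreover have "nilpotent_mat (nilpotent_part n)"
  proof (rule nilpotent_matI_terms)
    fix k
    show "mat_at k (nilpotent_part n) ^\<^sub>m (\<Sum>j\<in>J. t j) = 0\<^sub>m q q"
      unfolding mat_at_nilpotent_part[OF n] by (rule M_power_eq_0) (simp add: poly_semisimple)
  qed simp
  ultimately show ?thesis
    using power_seq_decomposition[OF n] diagonalizable_diagonalizable_part
    by (simp add: is_nilpotent_diagonalizable_sum_def)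
qed

lemma mat_at_diagonal: "diagonal_mat D \<Longrightarrow> diagonal_mat (mat_at k D)"
  for D :: "(nat \<Rightarrow> 'a) mat"
  by (simp add: diagonal_mat_def)

theorem nilpotent_diagonalizable_sum_unique:
  assumes n: "\<forall>j\<in>J - {z}. t j \<le> Suc n"
    and XY: "is_nilpotent_diagonalizable_sum q (power_seq A) X Y"
  shows "X = nilpotent_part n \<and> Y = diagonalizable_part"
proof -
  have X: "X \<in> carrier_mat q q" and Y: "Y \<in> carrier_mat q q" and sum: "power_seq A = X + Y"
    and comm: "X * Y = Y * X" and nil: "nilpotent_mat X" and diag: "diagonalizable_mat Y"
    using XY by (simp_all add: is_nilpotent_diagonalizable_sum_def)
  obtain e where e: "X ^\<^sub>m e = 0\<^sub>m q q" using nil X by (auto simp: nilpotent_mat_def)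
  obtain D where "similar_mat Y D" and D: "diagonal_mat D" using diag by (auto simp: diagonalizable_mat_def)
  then obtain q' P Q where q': "{Y, D, P, Q} \<subseteq> carrier_mat q' q'"
    and PQ: "P * Q = 1\<^sub>m q'" "Q * P = 1\<^sub>m q'" "Y = P * D * Q"
    using similar_matD by blast
  have "q' = q" using q' Y by auto
  note c = q'[unfolded this] and PQ = PQ[unfolded this]
  have YS: "Y = diagonalizable_part"
  proof (rule mat_at_eqI[OF Y diagonalizable_part_carrier])
    fix k
    have "mat_at k Y = M (semisimple (monom 1 k))"
    proof (rule semisimple_unique)
      show "M (monom 1 k) = mat_at k X + mat_at k Y"
        using X Y by (simp flip: power_A mat_at_power_seq[OF A] add: sum mat_at_add[of _ q q])
      show "mat_at k X * mat_at k Y = mat_at k Y * mat_at k X"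
        using X Y comm by (simp flip: mat_at_mult[of _ q q _ q])
      show "mat_at k X ^\<^sub>m e = 0\<^sub>m q q"
        using X e by (simp flip: mat_at_pow add: mat_at_zero)
      show "mat_at k Y = mat_at k P * mat_at k D * mat_at k Q"
        using c unfolding PQ(3)
        by (simp add: mat_at_mult[of "P * D" q q Q q] mat_at_mult[of P q q D q] mult_carrier_mat[of P q q D q]
            del: mult_carrier_mat)
      show "mat_at k P * mat_at k Q = 1\<^sub>m q" "mat_at k Q * mat_at k P = 1\<^sub>m q"
        using c PQ(1,2) by (simp_all flip: mat_at_mult[of _ q q _ q] add: mat_at_one)
    qed (use X Y c D in \<open>auto simp: mat_at_diagonal\<close>)
    then show "mat_at k Y = mat_at k diagonalizable_part" by (simp add: mat_at_diagonalizable_part)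
  qed
  have eq: "X + diagonalizable_part = nilpotent_part n + diagonalizable_part"
    using sum power_seq_decomposition[OF n] YS by simp
  have "X = nilpotent_part n"
  proof (rule eq_matI)
    fix r s assume "r < dim_row (nilpotent_part n)" "s < dim_col (nilpotent_part n)"
    then have rs: "r < q" "s < q" using carrier_matD[OF nilpotent_part_carrier] by simp_all
    have "(X + diagonalizable_part) $$ (r, s) = (nilpotent_part n + diagonalizable_part) $$ (r, s)"
      by (simp only: eq)
    then show "X $$ (r, s) = nilpotent_part n $$ (r, s)"
      using rs carrier_matD[OF diagonalizable_part_carrier] by simp
  qed (use X carrier_matD[OF nilpotent_part_carrier] in simp_all)
  with YS show ?thesis by simp
qed

end

section \<open>The coordinates, the non-geometric part and the decomposition\<close>

theorem proposition3p1:
  fixes A :: "'a::field mat" and q p :: nat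
    and lam :: "nat \<Rightarrow> 'a" and t :: "nat \<Rightarrow> nat"
    and m :: int and \<pi> :: "nat \<Rightarrow> 'a mat" and N :: "(nat \<Rightarrow> 'a) mat"
  assumes A: "A \<in> carrier_mat q q"
    and lam_0: "lam 0 = 0"
    and lam_nonzero: "\<And>j. j \<in> {1..p} \<Longrightarrow> lam j \<noteq> 0"
    and lam_distinct: "inj_on lam {1..p}"
    and t_pos: "\<And>j. j \<in> {1..p} \<Longrightarrow> t j \<ge> 1"
    and minpoly: "is_minimal_poly A ([:0, 1:] ^ t 0 * (\<Prod>j = 1..p. [:- lam j, 1:] ^ t j))"
    and m_eq: "m = (if p = 0 then -1 else Max ((\<lambda>j. int (t j) - 1) ` {1..p}))"
    and \<pi>_eq: "\<And>j. j \<in> {0..p} \<Longrightarrow> \<pi> j = spectral_projection A {0..p} lam t j"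
    and N_eq: "N = mat_sum q (\<lambda>i. seq_times_mat (delta_seq i) (A ^\<^sub>m i * \<pi> 0)) {1..<t 0}"
  shows
    "((\<forall>i\<ge>1. coordinate A i =
         mat_sum q (\<lambda>j. seq_times_mat (geo_seq (lam j))
           (inverse (lam j) ^ i \<cdot>\<^sub>m ((A - lam j \<cdot>\<^sub>m 1\<^sub>m q) ^\<^sub>m i * \<pi> j))) {1..p}) \<and>
       coordinate A 0 = mat_sum q (\<lambda>j. seq_times_mat (geo_seq (lam j)) (\<pi> j)) {1..p})
     \<and>
     (nongeometric_part A =
         mat_sum q (\<lambda>i. seq_times_mat (delta_seq i) (A ^\<^sub>m i * \<pi> 0)) {..<t 0} \<and>
       (nongeometric_part A = 0\<^sub>m q q \<longleftrightarrow> t 0 = 0))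
     \<and>
     ((nilpotent_mat A \<longleftrightarrow> (\<forall>i. coordinate A i = 0\<^sub>m q q)) \<and>
       ((\<forall>i. coordinate A i = 0\<^sub>m q q) \<longleftrightarrow> power_seq A = nongeometric_part A))
     \<and>
     (\<forall>i. coordinate A i = 0\<^sub>m q q \<longleftrightarrow> int i > m)
     \<and>
     (\<not> nilpotent_mat A \<longrightarrow>
       (\<forall>i. 1 \<le> i \<and> int i \<le> m \<longrightarrow> coordinate A i \<noteq> 0\<^sub>m q q))
     \<and>
     (\<forall>i\<ge>1. coordinate A i =
         mat_sum q (\<lambda>j. seq_times_mat (geo_seq (lam j))
           (inverse (lam j) ^ i \<cdot>\<^sub>m ((A - lam j \<cdot>\<^sub>m 1\<^sub>m q) ^\<^sub>m i * \<pi> j))) {1..p} \<and>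
       nilpotent_mat (coordinate A i))
     \<and>
     (nongeometric_part A = seq_times_mat (delta_seq 0) (\<pi> 0) + N \<and> nilpotent_mat N)
     \<and>
     (let X = N + mat_sum q (\<lambda>i. binom_seq i \<cdot>\<^sub>m coordinate A i) {1..nat m};
          Y = seq_times_mat (delta_seq 0) (\<pi> 0) + binom_seq 0 \<cdot>\<^sub>m coordinate A 0
      in is_nilpotent_diagonalizable_sum q (power_seq A) X Y \<and>
         (\<forall>X' Y'. is_nilpotent_diagonalizable_sum q (power_seq A) X' Y' \<longrightarrow> X' = X \<and> Y' = Y))"
proof -
  have J: "{0..p} = insert 0 {1..p}" and J0: "{0..p} - {0} = {1..p}" by auto
  have inj: "inj_on lam {0..p}"
    unfolding J using lam_distinct lam_0 lam_nonzero by (force simp: inj_on_insert)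
  have "[:0, 1:] ^ t 0 * (\<Prod>j = 1..p. [:- lam j, 1:] ^ t j) = (\<Prod>j\<in>{0..p}. [:- lam j, 1:] ^ t j)"
    unfolding J by (simp add: lam_0)
  with minpoly have min: "is_minimal_poly A (\<Prod>j\<in>{0..p}. [:- lam j, 1:] ^ t j)" by simp
  interpret split_minimal_poly_at_0 A q "{0..p}" lam t 0
    using A inj min lam_0 t_pos by unfold_locales (simp_all add: J0)
  have proj: "\<pi> j = M (idem j)" if "j \<in> {0..p}" for j
    using \<pi>_eq[OF that] spectral_projection_eq[OF that] by simp
  have M_proj: "(A - lam j \<cdot>\<^sub>m 1\<^sub>m q) ^\<^sub>m i * \<pi> j = M ([:- lam j, 1:] ^ i * idem j)" if "j \<in> {1..p}" for i j
    using that by (simp add: proj poly_mat_mult[OF A] poly_mat_power[OF A] poly_mat_linear[OF A])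
  have A_proj: "A ^\<^sub>m i * \<pi> 0 = M (monom 1 i * idem 0)" for i
    by (simp add: proj poly_mat_mult[OF A] power_A)
  have coord: "coordinate A i = mat_sum q (\<lambda>j. seq_times_mat (geo_seq (lam j))
      (inverse (lam j) ^ i \<cdot>\<^sub>m ((A - lam j \<cdot>\<^sub>m 1\<^sub>m q) ^\<^sub>m i * \<pi> j))) {1..p}" for i
    unfolding coordinate_eq coord_def J0 by (rule mat_sum_cong) (simp only: M_proj)
  have coord_0: "coordinate A 0 = mat_sum q (\<lambda>j. seq_times_mat (geo_seq (lam j)) (\<pi> j)) {1..p}"
    unfolding coordinate_eq coord_def J0
    by (rule mat_sum_cong) (simp add: proj one_smult_mat)
  have nongeo: "nongeometric_part A = mat_sum q (\<lambda>i. seq_times_mat (delta_seq i) (A ^\<^sub>m i * \<pi> 0)) {..<t 0}"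
    unfolding nongeometric_part_eq nongeo_def A_proj ..
  have N: "N = nongeo_nilpotent" unfolding N_eq nongeo_nilpotent_def A_proj ..
  have nil: "nilpotent_mat A \<longleftrightarrow> (\<forall>i. coordinate A i = 0\<^sub>m q q)"
    "(\<forall>i. coordinate A i = 0\<^sub>m q q) \<longleftrightarrow> power_seq A = nongeometric_part A"
    unfolding coordinate_eq nongeometric_part_eq nilpotent_iff coord_all_0_iff power_seq_eq_nongeo_iff
    by (rule refl)+
  \<comment> \<open>For \<open>p = 0\<close> both sides hold, as \<open>m = -1\<close>.\<close>
  have le_m: "(\<forall>j\<in>{1..p}. t j \<le> i) \<longleftrightarrow> int i > m" for i
  proof (cases "p = 0")
    case False
    then have "m < int i \<longleftrightarrow> (\<forall>j\<in>{1..p}. int (t j) - 1 < int i)"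
      unfolding m_eq by (subst if_not_P) (auto simp: Max_less_iff)
    then show ?thesis by fastforce
  qed (simp add: m_eq)
  have coord_eq_0: "coordinate A i = 0\<^sub>m q q \<longleftrightarrow> int i > m" for i
    unfolding coordinate_eq coord_eq_0_iff J0 by (rule le_m)
  have n: "\<forall>j\<in>{0..p} - {0}. t j \<le> Suc (nat m)"
    unfolding J0 le_m by simp
  have split: "nongeometric_part A = seq_times_mat (delta_seq 0) (\<pi> 0) + N"
    unfolding nongeometric_part_eq N by (simp add: nongeo_split proj)
  have XY: "N + mat_sum q (\<lambda>i. binom_seq i \<cdot>\<^sub>m coordinate A i) {1..nat m} = nilpotent_part (nat m)"
    "seq_times_mat (delta_seq 0) (\<pi> 0) + binom_seq 0 \<cdot>\<^sub>m coordinate A 0 = diagonalizable_part"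
    by (simp_all add: N nilpotent_part_def diagonalizable_part_def coordinate_eq proj)
  have decomposition: "let X = N + mat_sum q (\<lambda>i. binom_seq i \<cdot>\<^sub>m coordinate A i) {1..nat m};
          Y = seq_times_mat (delta_seq 0) (\<pi> 0) + binom_seq 0 \<cdot>\<^sub>m coordinate A 0
      in is_nilpotent_diagonalizable_sum q (power_seq A) X Y \<and>
         (\<forall>X' Y'. is_nilpotent_diagonalizable_sum q (power_seq A) X' Y' \<longrightarrow> X' = X \<and> Y' = Y)"
    unfolding XY Let_def
    using is_nilpotent_diagonalizable_sum_power_seq[OF n] nilpotent_diagonalizable_sum_unique[OF n] by blast
  have nongeo_0: "nongeometric_part A = 0\<^sub>m q q \<longleftrightarrow> t 0 = 0"
    unfolding nongeometric_part_eq by (rule nongeo_eq_0_iff)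
  have nil_coord: "nilpotent_mat (coordinate A i)" if "i \<ge> 1" for i
    unfolding coordinate_eq using that by (rule nilpotent_coord)
  have nil_N: "nilpotent_mat N" unfolding N by (rule nilpotent_nongeo_nilpotent)
  have nonzero: "coordinate A i \<noteq> 0\<^sub>m q q" if "int i \<le> m" for i
    using that by (simp add: coord_eq_0)
  show ?thesis
    by (intro conjI allI impI coord coord_0 nongeo nongeo_0 nil coord_eq_0 nil_coord split nil_N
        decomposition) (simp_all add: nonzero)
qed

end
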